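(* Let $r$ and $s$ be integers with $3\le r\le s$, and let $\Gamma$ be an unbalanced signed bipartite graph whose underlying graph has partite sets of sizes $r$ and $s$, such that $\Gamma$ contains no negative cycle of length $4$. Then \[ \rho(\Gamma)\le \sqrt{ \frac{1}{2}\left((r-1)(s-1)+2+\sqrt{((r-1)(s-1)+2)^2-4(2s-3)(2r-3)}\right)}, \] and equality holds if and only if $\Gamma$ is switching isomorphic to $\Gamma_{r,s}$.
   Context: All graphs are simple (not necessarily connected). A signed graph $\Gamma=(G,\sigma)$ is a simple graph $G$ together with a map $\sigma:E(G)\to\{-1,1\}$; an edge $e$ is positive if $\sigma(e)=1$ and negative if $\sigma(e)=-1$. The adjacency matrix $A(\Gamma)=(a_{uv})$ has $a_{uv}=\sigma(uv)$ if $uv\in E(G)$ and $a_{uv}=0$ otherwise; the spectral radius $\rho(\Gamma)$ is the largest absolute value of an eigenvalue of $A(\Gamma)$. A signed graph is bipartite if its underlying graph is bipartite. A cycle is negative if it contains an odd number of negative edges; $\Gamma$ is unbalanced if it contains at least one negative cycle. For $U\subseteq V(G)$, switching in $U$ reverses the signs of all edges with exactly one endpoint in $U$; two signed graphs are switching equivalent if one is obtained from the other by switching in some vertex subset, and switching isomorphic if one is isomorphic to a signed graph switching equivalent to the other. For $3\le r\le s$, $\Gamma_{r,s}$ denotes the signed bipartite graph obtained from the complete bipartite graph $K_{r-1,s-1}$ with all edges positive by deleting one edge $uv$ and adding two new vertices $u_1,v_1$ with edges $uv_1$, $v_1u_1$, $u_1v$ (a path of length three from $u$ to $v$), where $v_1u_1$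 is the only negative edge; it is an $r$ by $s$ bipartite signed graph. *)

theory Defs
  imports "Jordan_Normal_Form.Spectral_Radius"
begin

text \<open>Edges are two-element sets of vertices. The values of \<open>sign\<close> outside the edge set
  carry no meaning: every notion below depends on the signs of edges only.\<close>

record 'a sgraph =
  verts :: "'a set"
  edges :: "'a set set"
  sign :: "'a set \<Rightarrow> int"

definition signed_graph :: "'a sgraph \<Rightarrow> bool" where
  "signed_graph \<Gamma> \<longleftrightarrow> finite (verts \<Gamma>) \<and>
     (\<forall>e\<in>edges \<Gamma>. e \<subseteq> verts \<Gamma> \<and> card e = 2) \<and>
     (\<forall>e\<in>edges \<Gamma>. sign \<Gamma> e \<in> {-1, 1})"

text \<open>The adjacency matrix is taken with respect to an arbitrary enumeration of the vertices;
  different enumerations give permutation similar matrices, hence the same eigenvalues.\<close>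

definition vertex_list :: "'a sgraph \<Rightarrow> 'a list" where
  "vertex_list \<Gamma> = (SOME vs. distinct vs \<and> set vs = verts \<Gamma>)"

definition adj :: "'a sgraph \<Rightarrow> 'a \<Rightarrow> 'a \<Rightarrow> int" where
  "adj \<Gamma> u v = (if {u, v} \<in> edges \<Gamma> then sign \<Gamma> {u, v} else 0)"

definition adj_matrix :: "'a sgraph \<Rightarrow> complex mat" where
  "adj_matrix \<Gamma> = (let vs = vertex_list \<Gamma>; n = card (verts \<Gamma>)
     in mat n n (\<lambda>(i, j). of_int (adj \<Gamma> (vs ! i) (vs ! j))))"

definition sg_radius :: "'a sgraph \<Rightarrow> real" where
  "sg_radius \<Gamma> = spectral_radius (adj_matrix \<Gamma>)"

definition bipartition :: "'a sgraph \<Rightarrow> 'a set \<Rightarrow> 'a set \<Rightarrow> bool" where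
  "bipartition \<Gamma> X Y \<longleftrightarrow> X \<union> Y = verts \<Gamma> \<and> X \<inter> Y = {} \<and>
     (\<forall>e\<in>edges \<Gamma>. \<exists>x\<in>X. \<exists>y\<in>Y. e = {x, y})"

text \<open>A cycle is given by the list of its vertices in cyclic order.\<close>

definition cycle_edges :: "'a list \<Rightarrow> 'a set set" where
  "cycle_edges c = {{c ! i, c ! (Suc i mod length c)} | i. i < length c}"

definition is_cycle :: "'a sgraph \<Rightarrow> 'a list \<Rightarrow> bool" where
  "is_cycle \<Gamma> c \<longleftrightarrow> 3 \<le> length c \<and> distinct c \<and> set c \<subseteq> verts \<Gamma> \<and> cycle_edges c \<subseteq> edges \<Gamma>"

definition negative_cycle :: "'a sgraph \<Rightarrow> 'a list \<Rightarrow> bool" where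
  "negative_cycle \<Gamma> c \<longleftrightarrow> is_cycle \<Gamma> c \<and> odd (card {e \<in> cycle_edges c. sign \<Gamma> e = -1})"

definition unbalanced :: "'a sgraph \<Rightarrow> bool" where
  "unbalanced \<Gamma> \<longleftrightarrow> (\<exists>c. negative_cycle \<Gamma> c)"

definition switch :: "'a set \<Rightarrow> 'a sgraph \<Rightarrow> 'a sgraph" where
  "switch U \<Gamma> = \<Gamma>\<lparr>sign := \<lambda>e. if card (e \<inter> U) = 1 then - sign \<Gamma> e else sign \<Gamma> e\<rparr>"

definition same_sgraph :: "'a sgraph \<Rightarrow> 'a sgraph \<Rightarrow> bool" where
  "same_sgraph \<Gamma> \<Delta> \<longleftrightarrow> verts \<Gamma> = verts \<Delta> \<and> edges \<Gamma> = edges \<Delta> \<and>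
     (\<forall>e\<in>edges \<Gamma>. sign \<Gamma> e = sign \<Delta> e)"

definition switching_equivalent :: "'a sgraph \<Rightarrow> 'a sgraph \<Rightarrow> bool" where
  "switching_equivalent \<Gamma> \<Delta> \<longleftrightarrow> (\<exists>U\<subseteq>verts \<Delta>. same_sgraph \<Gamma> (switch U \<Delta>))"

definition isomorphic :: "'a sgraph \<Rightarrow> 'b sgraph \<Rightarrow> bool" where
  "isomorphic \<Gamma> \<Delta> \<longleftrightarrow> (\<exists>f. bij_betw f (verts \<Gamma>) (verts \<Delta>) \<and>
     edges \<Delta> = (\<lambda>e. f ` e) ` edges \<Gamma> \<and> (\<forall>e\<in>edges \<Gamma>. sign \<Delta> (f ` e) = sign \<Gamma> e))"

definition switching_isomorphic :: "'a sgraph \<Rightarrow> 'b sgraph \<Rightarrow> bool" where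
  "switching_isomorphic \<Gamma> \<Delta> \<longleftrightarrow> (\<exists>\<Delta>'. switching_equivalent \<Delta>' \<Delta> \<and> isomorphic \<Gamma> \<Delta>')"

text \<open>The vertices of \<open>K\<^bsub>r-1,s-1\<^esub>\<close> are \<open>Inl 0, ..., Inl (r - 2)\<close> and
  \<open>Inr 0, ..., Inr (s - 2)\<close>; the deleted edge joins \<open>u = Inl 0\<close> and \<open>v = Inr 0\<close>, and the
  new vertices are \<open>u\<^sub>1 = Inl (r - 1)\<close> and \<open>v\<^sub>1 = Inr (s - 1)\<close>.\<close>

definition Gamma_rs :: "nat \<Rightarrow> nat \<Rightarrow> (nat + nat) sgraph" where
  "Gamma_rs r s = (let u = Inl 0; v = Inr 0; u1 = Inl (r - 1); v1 = Inr (s - 1);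
       K = {{Inl i, Inr j} | i j. i < r - 1 \<and> j < s - 1}
     in \<lparr>verts = Inl ` {..<r} \<union> Inr ` {..<s},
         edges = (K - {{u, v}}) \<union> {{u, v1}, {v1, u1}, {u1, v}},
         sign = (\<lambda>e. if e = {v1, u1} then -1 else 1)\<rparr>)"

end

theory Submission
  imports Defs
begin

text \<open>Let \<open>w\<close> be the \<open>X \<times> Y\<close> block of the adjacency matrix and \<open>2 w(f, g) \<le> \<beta> (|f|\<^sup>2 + |g|\<^sup>2)\<close> the
  inequality to be shown. Switch so that the value at \<open>|f|, |g|\<close> does not drop below \<open>w(f, g)\<close> and
  the number of negative edges is minimal. As \<open>\<Gamma>\<close> is unbalanced a negative edge \<open>u v\<close> is left; let
  \<open>P\<close> and \<open>Q\<close> be the positive neighbourhoods of \<open>v\<close> and \<open>u\<close>. Without negative 4-cycles there is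
  no positive edge between \<open>P\<close> and \<open>Q\<close>, and by minimality no cut has negative but no positive
  edges, so \<open>P\<close>, \<open>Q\<close> and their complements in \<open>X - {u}\<close> and \<open>Y - {v}\<close> are nonempty. Hence \<open>w\<close> is
  dominated entrywise by the blow-up of a negative hexagon with class sizes \<open>1, 1, p, q', p', q\<close>.
  Its nonzero squared eigenvalues are the roots of \<open>t\<^sup>2 - e t + m\<close> with
  \<open>e = (r - 1) (s - 1) + 2 - (p - 1) (q - 1)\<close> and \<open>m = (p p' + r - 1) (q q' + s - 1)\<close>; the larger
  root is greatest when \<open>e\<close> is maximal and \<open>m\<close> minimal, which forces two adjacent
  classes to absorb all the remaining vertices, that is, \<open>\<Gamma>\<^bsub>r,s\<^esub>\<close> up to switching.\<close>

section \<open>Estimates for the two quadratics\<close>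

text \<open>A nonnegative determinant makes the symmetric matrix with entries \<open>a\<close>,
  \<open>b\<close>, \<open>c\<close> semidefinite of one sign. A nonnegative trace against the
  positive definite matrix with diagonal \<open>\<gamma>\<close>, \<open>\<alpha>\<close> and
  off-diagonal entry \<open>\<delta>\<close> rules out the negative sign.\<close>

lemma binary_form_nonneg:
  fixes a b c \<alpha> \<gamma> \<delta> :: real
  assumes det: "b\<^sup>2 \<le> a * c" and pos: "\<alpha> > 0" "\<gamma> > 0" and pd: "\<delta>\<^sup>2 < \<alpha> * \<gamma>"
    and tr: "0 \<le> \<gamma> * a + \<alpha> * c + 2 * \<delta> * b"
  shows "0 \<le> a * h\<^sup>2 + 2 * b * h * g + c * g\<^sup>2"
proof -
  consider "a > 0" | "a = 0" | "a < 0" by linarith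
  then show ?thesis
  proof cases
    case 1
    have "a * (a * h\<^sup>2 + 2 * b * h * g + c * g\<^sup>2) = (a * h + b * g)\<^sup>2 + (a * c - b\<^sup>2) * g\<^sup>2"
      by (simp add: power2_eq_square algebra_simps)
    also have "\<dots> \<ge> 0" using det by simp
    finally show ?thesis using 1 by (simp add: zero_le_mult_iff)
  next
    case 2
    then have "b = 0" using det by simp
    then have "c \<ge> 0" using tr 2 pos by (simp add: zero_le_mult_iff)
    then show ?thesis using 2 \<open>b = 0\<close> by simp
  next
    case 3
    have ac: "a * c \<ge> 0" using det by (meson order_trans zero_le_power2)
    then have "c \<le> 0" using 3 by (simp add: zero_le_mult_iff)
    then have neg: "\<gamma> * a + \<alpha> * c < 0"
      using 3 pos by (meson add_neg_nonpos mult_pos_neg mult_nonneg_nonpos less_imp_le)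
    then have "(- (\<gamma> * a + \<alpha> * c))\<^sup>2 \<le> (2 * \<delta> * b)\<^sup>2"
      by (intro power_mono) (use tr in auto)
    also have "(2 * \<delta> * b)\<^sup>2 = 4 * \<delta>\<^sup>2 * b\<^sup>2" by (simp add: power2_eq_square)
    also have "\<dots> \<le> 4 * \<delta>\<^sup>2 * (a * c)" by (intro mult_left_mono det) simp
    \<comment> \<open>Both summands are nonnegative, so both vanish; this gives \<open>a = 0\<close>
      against \<open>a < 0\<close>.\<close>
    finally have "(\<gamma> * a - \<alpha> * c)\<^sup>2 + 4 * (\<alpha> * \<gamma> - \<delta>\<^sup>2) * (a * c) \<le> 0"
      by (simp add: power2_eq_square algebra_simps)
    moreover have "4 * (\<alpha> * \<gamma> - \<delta>\<^sup>2) * (a * c) \<ge> 0" using pd ac by simp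
    ultimately have "(\<gamma> * a - \<alpha> * c)\<^sup>2 \<le> 0" "(\<alpha> * \<gamma> - \<delta>\<^sup>2) * (a * c) \<le> 0"
      using zero_le_power2[of "\<gamma> * a - \<alpha> * c"] by linarith+
    moreover have "(\<alpha> * \<gamma> - \<delta>\<^sup>2) * (a * c) > 0" if "a * c \<noteq> 0"
      using that pd order_le_neq_trans[OF ac] by (intro mult_pos_pos[of _ "a * c"]) auto
    ultimately have "\<gamma> * a = \<alpha> * c" "a * c = 0" by fastforce+
    then show ?thesis using 3 pos by auto
  qed
qed

text \<open>In terms of \<open>h = b + c\<close> and \<open>g = c + v\<close> the left-hand side has rank two, and minimising the
  right-hand side for fixed \<open>h\<close> and \<open>g\<close> leaves a binary quadratic form whose determinant is
  \<open>t\<^sup>2 - e t + m\<close> up to a positive factor.\<close>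

lemma block_form_le:
  fixes p p' q q' t b c v :: real
  assumes pos: "p > 0" "p' > 0" "q > 0" "q' > 0"
    and e: "e = p * q' + p' * q + p' * q' + p + q + 1"
    and m: "m = (p * p' + p + p') * (q * q' + q + q')"
    and t: "e \<le> 2 * t" "0 \<le> t\<^sup>2 - e * t + m"
  shows "p * (c + v)\<^sup>2 + p' * (b + c)\<^sup>2 + (b - v)\<^sup>2 \<le> t * (b\<^sup>2 / q + c\<^sup>2 / q' + v\<^sup>2)"
proof -
  define \<kappa> where "\<kappa> = q * q' + q + q'"
  define h g where "h = b + c" and "g = c + v"
  have kpos: "\<kappa> > 0" using pos by (simp add: \<kappa>_def add_pos_pos)
  have tpos: "t > 0"
  proof -
    have "e > 0" using pos unfolding e by (intro add_pos_pos mult_pos_pos) auto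
    then show ?thesis using t by linarith
  qed
  \<comment> \<open>The form is t S - \<open>\<kappa>\<close> R in \<open>h\<close> and
    \<open>g\<close>, where R is the left-hand side of the claim, S / \<open>\<kappa>\<close> is the
    minimised weighted norm and det S = \<open>\<kappa>\<close>. The weights
    \<open>\<alpha>\<close>, \<open>\<gamma>\<close>, \<open>\<delta>\<close> are the entries of the
    adjugate of S, which turns the trace condition into \<open>e \<le> 2 * t\<close>.\<close>
  have A: "0 \<le> (t * (1 + q') - \<kappa> * (p' + 1)) * h\<^sup>2 + 2 * (\<kappa> - t * q') * h * g
      + (t * (q + q') - \<kappa> * (p + 1)) * g\<^sup>2"
  proof (rule binary_form_nonneg[where \<alpha> = "1 + q'" and \<gamma> = "q + q'" and \<delta> = "q'"])
    have "(t * (1 + q') - \<kappa> * (p' + 1)) * (t * (q + q') - \<kappa> * (p + 1)) - (\<kappa> - t * q')\<^sup>2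
        = \<kappa> * (t\<^sup>2 - e * t + m)"
      unfolding e m \<kappa>_def by (simp add: power2_eq_square algebra_simps)
    also have "\<dots> \<ge> 0" using kpos t by simp
    finally show "(\<kappa> - t * q')\<^sup>2 \<le> (t * (1 + q') - \<kappa> * (p' + 1)) * (t * (q + q') - \<kappa> * (p + 1))"
      by simp
    have "(q + q') * (t * (1 + q') - \<kappa> * (p' + 1)) + (1 + q') * (t * (q + q') - \<kappa> * (p + 1))
        + 2 * q' * (\<kappa> - t * q') = \<kappa> * (2 * t - e)"
      unfolding e \<kappa>_def by (simp add: power2_eq_square algebra_simps)
    then show "0 \<le> (q + q') * (t * (1 + q') - \<kappa> * (p' + 1))
        + (1 + q') * (t * (q + q') - \<kappa> * (p + 1)) + 2 * q' * (\<kappa> - t * q')"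
      using kpos t by simp
    show "q'\<^sup>2 < (1 + q') * (q + q')"
      using pos by (simp add: power2_eq_square algebra_simps add_pos_pos)
  qed (use pos in auto)
  \<comment> \<open>Completing the square along the direction that fixes \<open>h\<close> and
    \<open>g\<close>; the last summand vanishes exactly at the minimiser.\<close>
  have B: "\<kappa> * (b\<^sup>2 / q + c\<^sup>2 / q' + v\<^sup>2)
      = (1 + q') * h\<^sup>2 - 2 * q' * h * g + (q + q') * g\<^sup>2 + q * q' * (c / q' - b / q - v)\<^sup>2"
    using pos unfolding \<kappa>_def h_def g_def by (simp add: field_simps power2_eq_square)
  have "\<kappa> * (p * (c + v)\<^sup>2 + p' * (b + c)\<^sup>2 + (b - v)\<^sup>2)
      = \<kappa> * ((p' + 1) * h\<^sup>2 - 2 * h * g + (p + 1) * g\<^sup>2)"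
    unfolding h_def g_def by (simp add: power2_eq_square algebra_simps)
  also have "\<dots> \<le> t * ((1 + q') * h\<^sup>2 - 2 * q' * h * g + (q + q') * g\<^sup>2)"
    using A by (simp add: algebra_simps)
  also have "\<dots> \<le> t * (\<kappa> * (b\<^sup>2 / q + c\<^sup>2 / q' + v\<^sup>2))"
    unfolding B using tpos pos by (intro mult_left_mono) auto
  finally have "\<kappa> * (p * (c + v)\<^sup>2 + p' * (b + c)\<^sup>2 + (b - v)\<^sup>2)
      \<le> \<kappa> * (t * (b\<^sup>2 / q + c\<^sup>2 / q' + v\<^sup>2))" by (simp add: mult.left_commute)
  then show ?thesis using kpos by simp
qed

text \<open>Counterpart of \<open>block_form_le\<close> for equality: the class sums of an
  eigenvector satisfy a closed system, which in \<open>h\<close> and \<open>g\<close> is two by two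
  with characteristic polynomial \<open>t\<^sup>2 - e * t + m\<close>. Eliminating \<open>g\<close>
  leaves this polynomial times \<open>h\<close>.\<close>

lemma block_eigen_eq:
  fixes p p' q q' t b c v :: real
  assumes e: "e = p * q' + p' * q + p' * q' + p + q + 1"
    and m: "m = (p * p' + p + p') * (q * q' + q + q')"
    and eqs: "t * b = q * (p' * (b + c) + (b - v))" "t * c = q' * (p * (c + v) + p' * (b + c))"
      "t * v = p * (c + v) - (b - v)"
    and nz: "b + c \<noteq> 0"
  shows "t\<^sup>2 - e * t + m = 0"
proof -
  define h g where "h = b + c" and "g = c + v"
  have 1: "(t - q * (p' + 1) - q' * p') * h + (q - q' * p) * g = 0"
    using eqs(1,2) unfolding h_def g_def by (simp add: algebra_simps)
  have 2: "(t - q' * p - p - 1) * g + (1 - q' * p') * h = 0"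
    using eqs(2,3) unfolding h_def g_def by (simp add: algebra_simps)
  have "(t\<^sup>2 - e * t + m) * h = (t - q' * p - p - 1) * ((t - q * (p' + 1) - q' * p') * h + (q - q' * p) * g)
      - (q - q' * p) * ((t - q' * p - p - 1) * g + (1 - q' * p') * h)"
    unfolding e m by (simp add: power2_eq_square algebra_simps)
  also have "\<dots> = 0" by (simp only: 1 2 mult_zero_right diff_self)
  finally show ?thesis using nz by (simp add: h_def)
qed

text \<open>The square of the claimed bound for \<open>k = r - 1\<close> and
  \<open>n = s - 1\<close>: the larger root of \<open>t\<^sup>2 - e * t + m\<close> in the case
  \<open>p = q = 1\<close>, where \<open>e = k * n + 2\<close> and
  \<open>m = (2 * k - 1) * (2 * n - 1)\<close>.\<close>

definition beta_sq :: "real \<Rightarrow> real \<Rightarrow> real" where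
  "beta_sq k n = 1/2 * (k * n + 2 + sqrt ((k * n + 2)\<^sup>2 - 4 * (2 * n - 1) * (2 * k - 1)))"

lemma beta_sq:
  assumes "k \<ge> 2" "n \<ge> 2"
  shows "(beta_sq k n)\<^sup>2 - (k * n + 2) * beta_sq k n + (2 * k - 1) * (2 * n - 1) = 0"
    and "k * n + 2 \<le> 2 * beta_sq k n" and "beta_sq k n \<ge> 3"
proof -
  define D where "D = (k * n + 2)\<^sup>2 - 4 * (2 * n - 1) * (2 * k - 1)"
  \<comment> \<open>The discriminant is split into terms that are visibly nonnegative for
    \<open>k, n \<ge> 2\<close>.\<close>
  have "D = 4 * (n - 2)\<^sup>2 + 4 * (k - 2) * ((n - 1) * (n - 2)) + (k - 2)\<^sup>2 * n\<^sup>2"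
    unfolding D_def by (simp add: power2_eq_square algebra_simps)
  moreover have "4 * (k - 2) * ((n - 1) * (n - 2)) \<ge> 0" using assms by simp
  ultimately have D: "D \<ge> 0" by simp
  have b: "beta_sq k n = (k * n + 2 + sqrt D) / 2" by (simp add: beta_sq_def D_def)
  have sq: "sqrt D * sqrt D = D" using D by simp
  have "(beta_sq k n)\<^sup>2 - (k * n + 2) * beta_sq k n = (sqrt D * sqrt D - (k * n + 2)\<^sup>2) / 4"
    unfolding b by (simp add: power2_eq_square field_simps)
  then show "(beta_sq k n)\<^sup>2 - (k * n + 2) * beta_sq k n + (2 * k - 1) * (2 * n - 1) = 0"
    unfolding sq by (simp add: D_def field_simps)
  show le: "k * n + 2 \<le> 2 * beta_sq k n" unfolding b using D by simp
  have "2 * 2 \<le> k * n" using assms by (intro mult_mono) auto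
  then show "beta_sq k n \<ge> 3" using le by linarith
qed

text \<open>At the root belonging to \<open>p = q = 1\<close> the quadratic of an arbitrary blow-up
  takes the value \<open>(p - 1) * (q - 1) * t + (2 * k - 1) * j + (2 * n - 1) * i + i * j\<close>.
  No term is negative, and the value is zero only if the three defect products vanish.\<close>

lemma beta_sq_block:
  fixes p p' q q' k n :: real
  assumes "p \<ge> 1" "p' \<ge> 1" "p + p' = k" "q \<ge> 1" "q' \<ge> 1" "q + q' = n"
  defines "e \<equiv> p * q' + p' * q + p' * q' + p + q + 1"
    and "m \<equiv> (p * p' + p + p') * (q * q' + q + q')"
  shows "e \<le> 2 * beta_sq k n" "0 \<le> (beta_sq k n)\<^sup>2 - e * beta_sq k n + m"
    and "(beta_sq k n)\<^sup>2 - e * beta_sq k n + m = 0 \<Longrightarrow>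
      (p = 1 \<or> q = 1) \<and> (p = 1 \<or> p' = 1) \<and> (q = 1 \<or> q' = 1)"
proof -
  define t where "t = beta_sq k n"
  have kn: "k \<ge> 2" "n \<ge> 2" using assms by auto
  note t = beta_sq[OF kn, folded t_def]
  have e: "e = k * n + 2 - (p - 1) * (q - 1)"
    unfolding e_def assms(3,6)[symmetric] by (simp add: algebra_simps)
  have pq: "(p - 1) * (q - 1) \<ge> 0" using assms by simp
  show "e \<le> 2 * t" using e pq t(2) by linarith
  have m: "m = (p * p' + k) * (q * q' + n)"
    unfolding m_def assms(3,6)[symmetric] by (simp add: algebra_simps)
  \<comment> \<open>For a fixed sum \<open>p + p'\<close> the product \<open>p * p'\<close> is least
    when one factor is 1; \<open>i\<close> and \<open>j\<close> are the excesses over these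
    minima.\<close>
  define i where "i = (p - 1) * (p' - 1)"
  define j where "j = (q - 1) * (q' - 1)"
  have ij: "i \<ge> 0" "j \<ge> 0" using assms by (auto simp: i_def j_def)
  have "p * p' + k = 2 * k - 1 + i" "q * q' + n = 2 * n - 1 + j"
    unfolding assms(3,6)[symmetric] i_def j_def by (simp_all add: algebra_simps)
  then have m': "m = (2 * k - 1) * (2 * n - 1) + (2 * k - 1) * j + (2 * n - 1) * i + i * j"
    unfolding m by (simp only:) (simp add: algebra_simps)
  have key: "t\<^sup>2 - e * t + m = (p - 1) * (q - 1) * t + (2 * k - 1) * j + (2 * n - 1) * i + i * j"
    using t(1) unfolding e m' by (simp add: algebra_simps)
  have nn: "(p - 1) * (q - 1) * t \<ge> 0" "(2 * k - 1) * j \<ge> 0" "(2 * n - 1) * i \<ge> 0" "i * j \<ge> 0"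
    using pq t(3) kn ij by auto
  then show "0 \<le> t\<^sup>2 - e * t + m" unfolding key by linarith
  assume "t\<^sup>2 - e * t + m = 0"
  then have "(p - 1) * (q - 1) * t = 0" "(2 * k - 1) * j = 0" "(2 * n - 1) * i = 0"
    unfolding key using nn by linarith+
  then have "(p - 1) * (q - 1) = 0" "j = 0" "i = 0" using t(3) kn by auto
  then show "(p = 1 \<or> q = 1) \<and> (p = 1 \<or> p' = 1) \<and> (q = 1 \<or> q' = 1)"
    by (auto simp: i_def j_def)
qed

section \<open>Bilinear forms of blown-up negative hexagons\<close>

text \<open>For the bipartite block \<open>w\<close>, twice this value is the quadratic form of the
  full symmetric matrix at the vector composed of \<open>f\<close> and \<open>g\<close>.\<close>

definition bil :: "'a set \<Rightarrow> 'b set \<Rightarrow> ('a \<Rightarrow> 'b \<Rightarrow> real) \<Rightarrow> ('a \<Rightarrow> real) \<Rightarrow> ('b \<Rightarrow> real) \<Rightarrow> real" where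
  "bil X Y w f g = (\<Sum>x\<in>X. \<Sum>y\<in>Y. w x y * f x * g y)"

definition sqn :: "'a set \<Rightarrow> ('a \<Rightarrow> real) \<Rightarrow> real" where
  "sqn X f = (\<Sum>x\<in>X. (f x)\<^sup>2)"

lemma bil_rows: "bil X Y w f g = (\<Sum>x\<in>X. f x * (\<Sum>y\<in>Y. w x y * g y))"
  by (simp add: bil_def sum_distrib_left mult_ac)

lemma bil_swap: "bil X Y w f g = bil Y X (\<lambda>y x. w x y) g f"
  unfolding bil_def by (subst sum.swap) (simp add: mult_ac)

lemma sqn_nonneg: "sqn X f \<ge> 0"
  by (simp add: sqn_def sum_nonneg)

lemma sqn_abs [simp]: "sqn X (\<lambda>x. \<bar>f x\<bar>) = sqn X f"
  by (simp add: sqn_def)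

lemma sqn_eq_0_iff: "finite X \<Longrightarrow> sqn X f = 0 \<longleftrightarrow> (\<forall>x\<in>X. f x = 0)"
  by (simp add: sqn_def sum_nonneg_eq_0_iff)

text \<open>The arithmetic-geometric mean inequality with weight \<open>\<beta>\<close> removes
  \<open>f\<close>, so that only a norm bound on the row sums remains, which involves
  \<open>g\<close> alone.\<close>

lemma bil_le_of_rows_le:
  assumes b: "\<beta> > 0" and le: "sqn X (\<lambda>x. \<Sum>y\<in>Y. w x y * g y) \<le> \<beta>\<^sup>2 * sqn Y g"
  shows "2 * bil X Y w f g \<le> \<beta> * (sqn X f + sqn Y g)"
proof -
  define R where "R x = (\<Sum>y\<in>Y. w x y * g y)" for x
  have "\<beta> * (2 * bil X Y w f g) = (\<Sum>x\<in>X. 2 * (\<beta> * f x) * R x)"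
    by (simp add: bil_rows R_def sum_distrib_left mult_ac)
  also have "\<dots> \<le> (\<Sum>x\<in>X. (\<beta> * f x)\<^sup>2 + (R x)\<^sup>2)"
    by (intro sum_mono sum_squares_bound)
  also have "\<dots> = \<beta>\<^sup>2 * sqn X f + sqn X R"
    by (simp add: sqn_def sum.distrib sum_distrib_left power_mult_distrib)
  also have "\<dots> \<le> \<beta>\<^sup>2 * sqn X f + \<beta>\<^sup>2 * sqn Y g" using le unfolding R_def by simp
  finally have "\<beta> * (2 * bil X Y w f g) \<le> \<beta> * (\<beta> * (sqn X f + sqn Y g))"
    by (simp add: power2_eq_square algebra_simps)
  then show ?thesis using b by simp
qed

text \<open>For fixed \<open>g\<close> the form is compared at \<open>f\<close> and at its optimal partner, which is
  \<open>1 / \<beta>\<close> times the vector of row sums.\<close>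

lemma bil_max_eigen:
  assumes fin: "finite X" and b: "\<beta> > 0"
    and le: "\<And>f g. 2 * bil X Y w f g \<le> \<beta> * (sqn X f + sqn Y g)"
    and eq: "2 * bil X Y w f g = \<beta> * (sqn X f + sqn Y g)" and x: "x \<in> X"
  shows "(\<Sum>y\<in>Y. w x y * g y) = \<beta> * f x"
proof -
  define R where "R x = (\<Sum>y\<in>Y. w x y * g y)" for x
  have "bil X Y w R g = sqn X R"
    by (simp add: bil_rows R_def sqn_def power2_eq_square)
  moreover have "bil X Y w (\<lambda>x. R x / \<beta>) g = bil X Y w R g / \<beta>"
    by (simp add: bil_def sum_divide_distrib)
  moreover have "sqn X (\<lambda>x. R x / \<beta>) = sqn X R / \<beta>\<^sup>2"
    by (simp add: sqn_def sum_divide_distrib power_divide)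
  ultimately have "2 * (sqn X R / \<beta>) \<le> \<beta> * (sqn X R / \<beta>\<^sup>2 + sqn Y g)"
    using le[of "\<lambda>x. R x / \<beta>" g] by simp
  then have 1: "sqn X R \<le> \<beta>\<^sup>2 * sqn Y g"
    using b by (simp add: field_simps power2_eq_square)
  \<comment> \<open>The residual of the eigenvalue equation is expanded; its squared norm turns out
    to be nonpositive by \<open>1\<close>.\<close>
  have "sqn X (\<lambda>x. \<beta> * f x - R x) = \<beta>\<^sup>2 * sqn X f - \<beta> * (2 * bil X Y w f g) + sqn X R"
    unfolding bil_rows sqn_def R_def[symmetric]
    by (simp add: sum_distrib_left power2_diff sum.distrib sum_subtractf power_mult_distrib mult_ac)
  also have "\<dots> = sqn X R - \<beta>\<^sup>2 * sqn Y g"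
    unfolding eq by (simp add: power2_eq_square algebra_simps)
  finally have "sqn X (\<lambda>x. \<beta> * f x - R x) = 0"
    using 1 sqn_nonneg[of X "\<lambda>x. \<beta> * f x - R x"] by simp
  then show ?thesis using fin x by (simp add: sqn_eq_0_iff R_def)
qed

text \<open>The blow-up of a negative hexagon with the six classes \<open>{u}\<close>, \<open>{v}\<close>, \<open>P\<close>,
  \<open>Y - {v} - Q\<close>, \<open>X - {u} - P\<close>, \<open>Q\<close> in cyclic order, whose negative edge is \<open>u v\<close>.\<close>

definition hexsign :: "'a set \<Rightarrow> 'b set \<Rightarrow> 'a \<Rightarrow> 'b \<Rightarrow> 'a \<Rightarrow> 'b \<Rightarrow> real" where
  "hexsign P Q u v x y =
    (if x = u then (if y = v then -1 else if y \<in> Q then 1 else 0)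
     else if x \<in> P then (if y \<in> Q then 0 else 1)
     else (if y = v then 0 else 1))"

text \<open>Exchanging the two sides reflects the hexagon and keeps its negative edge, so column
  sums are row sums of the swapped blow-up.\<close>

lemma hexsign_swap:
  "u \<notin> P \<Longrightarrow> v \<notin> Q \<Longrightarrow> hexsign P Q u v x y = hexsign Q P v u y x"
  by (auto simp: hexsign_def)

locale hex_blowup =
  fixes X P :: "'a set" and Y Q :: "'b set" and u :: 'a and v :: 'b
  assumes fin: "finite X" "finite Y"
    and u: "u \<in> X" "P \<subseteq> X - {u}" "P \<noteq> {}" "X - {u} - P \<noteq> {}"
    and v: "v \<in> Y" "Q \<subseteq> Y - {v}" "Q \<noteq> {}" "Y - {v} - Q \<noteq> {}"
begin

lemma split_sum:
  "sum f Y = f v + sum f Q + sum f (Y - {v} - Q)" for f :: "'b \<Rightarrow> real"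
proof -
  have "sum f Y = f v + sum f (Y - {v})" using v fin by (simp add: sum.remove)
  also have "sum f (Y - {v}) = sum f Q + sum f (Y - {v} - Q)"
    using v fin by (subst sum.subset_diff[of Q]) auto
  finally show ?thesis by simp
qed

text \<open>A row depends only on the class of \<open>x\<close>, and \<open>g\<close> enters only
  through its sums over the three classes of \<open>Y\<close>. This reduces the norm bound to the
  three variables of \<open>block_form_le\<close>.\<close>

lemma row_sum:
  "(\<Sum>y\<in>Y. hexsign P Q u v x y * g y) =
    (if x = u then sum g Q - g v else if x \<in> P then sum g (Y - {v} - Q) + g v
     else sum g Q + sum g (Y - {v} - Q))"
proof -
  have "v \<notin> Q" using v by auto
  have "(\<Sum>y\<in>Q. hexsign P Q u v x y * g y) =
      (if x = u then sum g Q else if x \<in> P then 0 else sum g Q)"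
    "(\<Sum>y\<in>Y - {v} - Q. hexsign P Q u v x y * g y) =
      (if x = u then 0 else sum g (Y - {v} - Q))"
    using \<open>v \<notin> Q\<close> by (auto simp: hexsign_def intro!: sum.neutral sum.cong split: if_splits)
  then show ?thesis
    unfolding split_sum using \<open>v \<notin> Q\<close> by (simp add: hexsign_def)
qed

end

lemma hex_blowup_swap: "hex_blowup X P Y Q u v \<Longrightarrow> hex_blowup Y Q X P v u"
  by (simp add: hex_blowup_def)

text \<open>Cauchy-Schwarz against the constant vector, in the form that the squared deviations from
  the mean have a nonnegative sum.\<close>

lemma sum_sq_ge:
  fixes f :: "'a \<Rightarrow> real"
  assumes "finite A" "A \<noteq> {}"
  shows "(sum f A)\<^sup>2 / card A \<le> sqn A f"
proof -
  define m where "m = sum f A / card A"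
  have c: "real (card A) > 0" using assms by (simp add: card_gt_0_iff)
  have "0 \<le> (\<Sum>x\<in>A. (f x - m)\<^sup>2)" by (simp add: sum_nonneg)
  also have "\<dots> = sqn A f - 2 * m * sum f A + card A * m\<^sup>2"
  proof -
    have "(\<Sum>x\<in>A. 2 * f x * m) = 2 * m * sum f A"
      unfolding sum_distrib_left by (simp add: mult_ac)
    then show ?thesis by (simp add: sqn_def power2_diff sum.distrib sum_subtractf)
  qed
  also have "\<dots> = sqn A f - (sum f A)\<^sup>2 / card A"
    using c by (simp add: m_def field_simps power2_eq_square)
  finally show ?thesis by simp
qed

section \<open>Norm bound and equality case for a single blow-up\<close>

context hex_blowup
begin

abbreviation "p \<equiv> real (card P)"
abbreviation "p' \<equiv> real (card (X - {u} - P))"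
abbreviation "q \<equiv> real (card Q)"
abbreviation "q' \<equiv> real (card (Y - {v} - Q))"
abbreviation "t \<equiv> beta_sq (real (card X) - 1) (real (card Y) - 1)"

lemma fins: "finite P" "finite Q" "finite (X - {u} - P)" "finite (Y - {v} - Q)"
  using fin u v by (auto intro: finite_subset)

lemma card_ge_1:
  shows "p \<ge> 1" "p' \<ge> 1" "q \<ge> 1" "q' \<ge> 1"
  using fins u v by (simp_all add: Suc_le_eq card_gt_0_iff)

lemma split_sum': "sum f X = f u + sum f P + sum f (X - {u} - P)" for f :: "'a \<Rightarrow> real"
  using hex_blowup.split_sum[OF hex_blowup_swap[OF hex_blowup_axioms]] .

lemma card_split: "p + p' = real (card X) - 1" "q + q' = real (card Y) - 1"
  using split_sum[of "\<lambda>_. 1"] split_sum'[of "\<lambda>_. 1"] by simp_all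

lemmas block = beta_sq_block[OF card_ge_1(1,2) card_split(1) card_ge_1(3,4) card_split(2)]

lemma t_pos: "t > 0" "sqrt t > 0"
proof -
  have "t \<ge> 3" by (rule beta_sq) (use card_split card_ge_1 in linarith)+
  then show "t > 0" "sqrt t > 0" by simp_all
qed

text \<open>The squared norm of the row sums is the left-hand side of \<open>block_form_le\<close>;
  \<open>beta_sq_block\<close> supplies its hypotheses at \<open>t\<close>, and
  \<open>sum_sq_ge\<close> replaces the class sums by the norm of \<open>g\<close>.\<close>

lemma hexsign_bound:
  "2 * bil X Y (hexsign P Q u v) f g \<le> sqrt t * (sqn X f + sqn Y g)"
proof (rule bil_le_of_rows_le)
  define b c where "b = sum g Q" and "c = sum g (Y - {v} - Q)"
  have "sqn X (\<lambda>x. \<Sum>y\<in>Y. hexsign P Q u v x y * g y)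
      = p * (c + g v)\<^sup>2 + p' * (b + c)\<^sup>2 + (b - g v)\<^sup>2"
  proof -
    define R where "R x = (if x = u then b - g v else if x \<in> P then c + g v else b + c)\<^sup>2" for x
    have "u \<notin> P" using u by auto
    then have "sum R P = p * (c + g v)\<^sup>2"
      unfolding R_def by (subst sum.cong[OF refl, where h = "\<lambda>_. (c + g v)\<^sup>2"]) auto
    moreover have "sum R (X - {u} - P) = p' * (b + c)\<^sup>2"
      unfolding R_def by (subst sum.cong[OF refl, where h = "\<lambda>_. (b + c)\<^sup>2"]) auto
    moreover have "R u = (b - g v)\<^sup>2" by (simp add: R_def)
    ultimately show ?thesis
      unfolding sqn_def row_sum b_def[symmetric] c_def[symmetric] split_sum' R_def[symmetric]
      by simp
  qed
  also have "\<dots> \<le> t * (b\<^sup>2 / q + c\<^sup>2 / q' + (g v)\<^sup>2)"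
    by (rule block_form_le[OF _ _ _ _ refl refl])
      (use card_ge_1 block in auto)
  also have "\<dots> \<le> t * sqn Y g"
    using sum_sq_ge[OF fins(2) v(3), of g] sum_sq_ge[OF fins(4) v(4), of g] t_pos
    unfolding b_def c_def sqn_def split_sum by (intro mult_left_mono) auto
  finally show "sqn X (\<lambda>x. \<Sum>y\<in>Y. hexsign P Q u v x y * g y) \<le> (sqrt t)\<^sup>2 * sqn Y g"
    using t_pos by simp
qed (rule t_pos)

lemma hexsign_eigen:
  assumes "2 * bil X Y (hexsign P Q u v) f g = sqrt t * (sqn X f + sqn Y g)"
  shows "x \<in> X \<Longrightarrow> (\<Sum>y\<in>Y. hexsign P Q u v x y * g y) = sqrt t * f x"
    and "y \<in> Y \<Longrightarrow> (\<Sum>x\<in>X. hexsign P Q u v x y * f x) = sqrt t * g y"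
proof -
  show "x \<in> X \<Longrightarrow> (\<Sum>y\<in>Y. hexsign P Q u v x y * g y) = sqrt t * f x"
    using bil_max_eigen[OF fin(1) t_pos(2) hexsign_bound assms] .
  have le: "2 * bil Y X (\<lambda>y x. hexsign P Q u v x y) g f \<le> sqrt t * (sqn Y g + sqn X f)" for f g
    using hexsign_bound[of f g] by (simp add: bil_swap[of X] add.commute)
  show "y \<in> Y \<Longrightarrow> (\<Sum>x\<in>X. hexsign P Q u v x y * f x) = sqrt t * g y"
    by (rule bil_max_eigen[OF fin(2) t_pos(2) le])
      (use assms in \<open>simp_all add: bil_swap[of X] add.commute\<close>)
qed

text \<open>A nonnegative maximiser solves the eigenvalue equations in both directions. They
  propagate positivity through the hexagon except at \<open>u\<close> and \<open>v\<close>, where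
  the entry -1 interferes and only one positive value is guaranteed. The class sums then make
  \<open>t\<close> a root of the quadratic of this blow-up, and the equality case of
  \<open>beta_sq_block\<close> restricts the sizes.\<close>

lemma hexsign_equality:
  assumes eq: "2 * bil X Y (hexsign P Q u v) f g = sqrt t * (sqn X f + sqn Y g)"
    and nn: "\<forall>x\<in>X. f x \<ge> 0" "\<forall>y\<in>Y. g y \<ge> 0"
    and nz: "sqn X f + sqn Y g \<noteq> 0"
  shows "x \<in> X \<Longrightarrow> x \<noteq> u \<Longrightarrow> f x > 0" "y \<in> Y \<Longrightarrow> y \<noteq> v \<Longrightarrow> g y > 0" "f u > 0 \<or> g v > 0"
    and "(p = 1 \<or> q = 1) \<and> (p = 1 \<or> p' = 1) \<and> (q = 1 \<or> q' = 1)"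
proof -
  define B where "B = sqrt t"
  have B: "B > 0" "B * B = t" using t_pos by (simp_all add: B_def)
  define a a' where "a = sum f P" and "a' = sum f (X - {u} - P)"
  define b b' where "b = sum g Q" and "b' = sum g (Y - {v} - Q)"
  have uP: "u \<notin> P" and vQ: "v \<notin> Q" using u v by auto
  note ex = hexsign_eigen(1)[OF eq, unfolded row_sum, folded b_def b'_def B_def]
  have ey: "(if y = v then a - f u else if y \<in> Q then a' + f u else a + a') = B * g y" if "y \<in> Y" for y
    using hexsign_eigen(2)[OF eq that]
    unfolding hexsign_swap[OF uP vQ] hex_blowup.row_sum[OF hex_blowup_swap[OF hex_blowup_axioms]]
    unfolding a_def a'_def B_def .
  have fu: "b - g v = B * f u" using ex[OF u(1)] by simp
  have gv: "a - f u = B * g v" using ey[OF v(1)] by simp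
  have fP: "b' + g v = B * f x" if "x \<in> P" for x using ex[of x] that uP u by (auto split: if_splits)
  have fP': "b + b' = B * f x" if "x \<in> X - {u} - P" for x using ex[of x] that by (auto split: if_splits)
  have gQ: "a' + f u = B * g y" if "y \<in> Q" for y using ey[of y] that vQ v by (auto split: if_splits)
  have gQ': "a + a' = B * g y" if "y \<in> Y - {v} - Q" for y using ey[of y] that by (auto split: if_splits)
  have nn4: "a \<ge> 0" "a' \<ge> 0" "b \<ge> 0" "b' \<ge> 0" "f u \<ge> 0" "g v \<ge> 0"
    unfolding a_def a'_def b_def b'_def using nn u v by (auto intro!: sum_nonneg)
  \<comment> \<open>With all class sums zero, \<open>fu\<close> reads
    \<open>- g v = B * f u\<close>; by nonnegativity both sides vanish, and the remaining equations
    then kill the whole vector.\<close>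
  have zero: False if "a = 0" "a' = 0" "b = 0" "b' = 0"
  proof -
    have "B * f u \<ge> 0" using B nn4 by simp
    then have "g v = 0" using that fu nn4 by linarith
    then have 0: "f u = 0" "g v = 0" using that fu B by auto
    have "f x = 0" if "x \<in> X" for x
      using fP[of x] fP'[of x] that 0 B \<open>b = 0\<close> \<open>b' = 0\<close> by (cases "x \<in> P"; cases "x = u") auto
    moreover have "g y = 0" if "y \<in> Y" for y
      using gQ[of y] gQ'[of y] that 0 B \<open>a = 0\<close> \<open>a' = 0\<close> by (cases "y \<in> Q"; cases "y = v") auto
    ultimately show False using nz by (simp add: sqn_def)
  qed
  obtain x0 y0 where x0: "x0 \<in> X - {u} - P" and y0: "y0 \<in> Y - {v} - Q" using u v by auto
  have bb': "b + b' > 0"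
  proof (rule ccontr)
    assume "\<not> b + b' > 0"
    then have z: "b = 0" "b' = 0" using nn4 by linarith+
    have "B * f u \<ge> 0" using B nn4 by simp
    then have "g v = 0" using z fu nn4 by linarith
    then have "f u = 0" using z fu B by simp
    then have "a = 0" using gv \<open>g v = 0\<close> by simp
    moreover have "a' = 0" unfolding a'_def using fP' z B by (intro sum.neutral) auto
    ultimately show False using zero z by simp
  qed
  have aa': "a + a' > 0"
  proof (rule ccontr)
    assume "\<not> a + a' > 0"
    then have z: "a = 0" "a' = 0" using nn4 by linarith+
    have "B * g v \<ge> 0" using B nn4 by simp
    then have "f u = 0" using z gv nn4 by linarith
    then have "g v = 0" using z gv B by simp
    then have "b = 0" using fu \<open>f u = 0\<close> by simp
    moreover have "b' = 0" unfolding b'_def using gQ' z B by (intro sum.neutral) auto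
    ultimately show False using zero z by simp
  qed
  have fpos': "f x > 0" if "x \<in> X - {u} - P" for x
    using fP'[OF that] bb' B by (simp add: zero_less_mult_iff)
  have gpos': "g y > 0" if "y \<in> Y - {v} - Q" for y
    using gQ'[OF that] aa' B by (simp add: zero_less_mult_iff)
  \<comment> \<open>Positivity spreads from the two classes opposite the negative edge to
    \<open>P\<close> and \<open>Q\<close>.\<close>
  have a'pos: "a' > 0" and b'pos: "b' > 0"
    unfolding a'_def b'_def using fins fpos' gpos' u v by (auto intro!: sum_pos)
  have fposP: "f x > 0" if "x \<in> P" for x
  proof -
    have "B * f x > 0" using fP[OF that] b'pos nn4 by linarith
    then show ?thesis using B by (simp add: zero_less_mult_iff)
  qed
  have gposQ: "g y > 0" if "y \<in> Q" for y
  proof -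
    have "B * g y > 0" using gQ[OF that] a'pos nn4 by linarith
    then show ?thesis using B by (simp add: zero_less_mult_iff)
  qed
  show "x \<in> X \<Longrightarrow> x \<noteq> u \<Longrightarrow> f x > 0" using fposP[of x] fpos'[of x] by auto
  show "y \<in> Y \<Longrightarrow> y \<noteq> v \<Longrightarrow> g y > 0" using gposQ[of y] gpos'[of y] by auto
  have bpos: "b > 0" unfolding b_def using fins v gposQ by (intro sum_pos) auto
  show "f u > 0 \<or> g v > 0"
  proof (rule ccontr)
    assume "\<not> (f u > 0 \<or> g v > 0)"
    then have "f u = 0" "g v = 0" using nn4 by auto
    then show False using fu bpos by simp
  qed
  have Ba: "B * a = p * (b' + g v)" by (simp add: a_def sum_distrib_left fP[symmetric])
  have Ba': "B * a' = p' * (b + b')" by (simp add: a'_def sum_distrib_left fP'[symmetric])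
  have Bb: "B * b = q * (a' + f u)" by (simp add: b_def sum_distrib_left gQ[symmetric])
  have Bb': "B * b' = q' * (a + a')" by (simp add: b'_def sum_distrib_left gQ'[symmetric])
  \<comment> \<open>Multiplying the equations of the \<open>Y\<close> side by \<open>B\<close> and
    inserting those of the \<open>X\<close> side eliminates \<open>f\<close>, leaving the system of
    \<open>block_eigen_eq\<close>.\<close>
  have "t * b = q * (B * a' + B * f u)" "t * b' = q' * (B * a + B * a')"
    "t * g v = B * a - B * f u"
    unfolding B(2)[symmetric] mult.assoc Bb Bb' gv[symmetric] by (simp_all add: algebra_simps)
  then have "t * b = q * (p' * (b + b') + (b - g v))"
    "t * b' = q' * (p * (b' + g v) + p' * (b + b'))" "t * g v = p * (b' + g v) - (b - g v)"
    unfolding Ba Ba' fu[symmetric] .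
  from block_eigen_eq[OF refl refl this] bb'
  show "(p = 1 \<or> q = 1) \<and> (p = 1 \<or> p' = 1) \<and> (q = 1 \<or> q' = 1)"
    by (intro block(3)) simp
qed

end

section \<open>Arrays without negative quadrangles\<close>

definition is_signing :: "('a \<Rightarrow> real) \<Rightarrow> bool" where
  "is_signing \<theta> \<longleftrightarrow> (\<forall>x. \<theta> x = 1 \<or> \<theta> x = -1)"

text \<open>Switching, seen on the bipartite block: multiplication by diagonal sign matrices from
  the left and from the right.\<close>

definition resign :: "('a \<Rightarrow> real) \<Rightarrow> ('b \<Rightarrow> real) \<Rightarrow> ('a \<Rightarrow> 'b \<Rightarrow> real) \<Rightarrow> 'a \<Rightarrow> 'b \<Rightarrow> real" where
  "resign \<theta> \<eta> w x y = \<theta> x * w x y * \<eta> y"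

lemma is_signing_sq: "is_signing \<theta> \<Longrightarrow> \<theta> x * \<theta> x = 1"
  unfolding is_signing_def by (drule spec[of _ x]) auto

lemma bil_mono:
  assumes "\<And>x y. x \<in> X \<Longrightarrow> y \<in> Y \<Longrightarrow> w x y \<le> w' x y"
    and "\<And>x. f x \<ge> 0" "\<And>y. g y \<ge> 0"
  shows "bil X Y w f g \<le> bil X Y w' f g"
  unfolding bil_def by (intro sum_mono mult_right_mono assms)

text \<open>Resigning by the signs of \<open>f\<close> and \<open>g\<close> keeps the value while
  passing to absolute values. Among all pairs at least as good, one with the fewest negative entries
  is taken; a cut with a negative but no positive entry could be switched to do better.\<close>

lemma minimal_resigning:
  fixes w :: "'a \<Rightarrow> 'b \<Rightarrow> real"
  assumes fin: "finite X" "finite Y"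
  obtains \<theta> \<eta> where "is_signing \<theta>" "is_signing \<eta>"
    "bil X Y w f g \<le> bil X Y (resign \<theta> \<eta> w) (\<lambda>x. \<bar>f x\<bar>) (\<lambda>y. \<bar>g y\<bar>)"
    "\<And>U V x y. x \<in> X \<Longrightarrow> y \<in> Y \<Longrightarrow> (x \<in> U) \<noteq> (y \<in> V) \<Longrightarrow> resign \<theta> \<eta> w x y < 0 \<Longrightarrow>
      \<exists>x\<in>X. \<exists>y\<in>Y. (x \<in> U) \<noteq> (y \<in> V) \<and> resign \<theta> \<eta> w x y > 0"
proof -
  define S where "S = (\<lambda>(\<theta>, \<eta>). is_signing \<theta> \<and> is_signing \<eta> \<and>
    bil X Y w f g \<le> bil X Y (resign \<theta> \<eta> w) (\<lambda>x. \<bar>f x\<bar>) (\<lambda>y. \<bar>g y\<bar>))"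
  define neg where "neg = (\<lambda>(\<theta>, \<eta>). {(x, y) \<in> X \<times> Y. resign \<theta> \<eta> w x y < 0})"
  \<comment> \<open>Zero receives the sign 1, so that a signing results and
    \<open>s r * \<bar>r\<bar> = r\<close> still holds.\<close>
  define s where "s r = (if r < 0 then -1 else 1 :: real)" for r :: real
  have "S (\<lambda>x. s (f x), \<lambda>y. s (g y))"
  proof -
    have s: "s r * \<bar>r\<bar> = r" for r by (simp add: s_def)
    have "resign (\<lambda>x. s (f x)) (\<lambda>y. s (g y)) w x y * \<bar>f x\<bar> * \<bar>g y\<bar> = w x y * f x * g y" for x y
    proof -
      have "resign (\<lambda>x. s (f x)) (\<lambda>y. s (g y)) w x y * \<bar>f x\<bar> * \<bar>g y\<bar>
          = w x y * (s (f x) * \<bar>f x\<bar>) * (s (g y) * \<bar>g y\<bar>)"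
        by (simp only: resign_def mult_ac)
      then show ?thesis by (simp only: s)
    qed
    then have "bil X Y w f g = bil X Y (resign (\<lambda>x. s (f x)) (\<lambda>y. s (g y)) w) (\<lambda>x. \<bar>f x\<bar>) (\<lambda>y. \<bar>g y\<bar>)"
      by (simp only: bil_def)
    then show ?thesis by (simp add: S_def is_signing_def) (simp add: s_def)
  qed
  then obtain z where "S z" and min: "\<And>z'. S z' \<Longrightarrow> card (neg z) \<le> card (neg z')"
    using ex_has_least_nat[of S _ "\<lambda>z. card (neg z)"] by blast
  obtain \<theta> \<eta> where z: "z = (\<theta>, \<eta>)" by (cases z)
  have S: "is_signing \<theta>" "is_signing \<eta>"
    "bil X Y w f g \<le> bil X Y (resign \<theta> \<eta> w) (\<lambda>x. \<bar>f x\<bar>) (\<lambda>y. \<bar>g y\<bar>)"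
    using \<open>S z\<close> by (auto simp: S_def z)
  have "\<exists>x\<in>X. \<exists>y\<in>Y. (x \<in> U) \<noteq> (y \<in> V) \<and> resign \<theta> \<eta> w x y > 0"
    if xy: "x0 \<in> X" "y0 \<in> Y" "(x0 \<in> U) \<noteq> (y0 \<in> V)" "resign \<theta> \<eta> w x0 y0 < 0" for U V x0 y0
  proof (rule ccontr)
    assume "\<not> ?thesis"
    then have npos: "\<And>x y. x \<in> X \<Longrightarrow> y \<in> Y \<Longrightarrow> (x \<in> U) \<noteq> (y \<in> V) \<Longrightarrow> resign \<theta> \<eta> w x y \<le> 0"
      by force
    \<comment> \<open>Switching in \<open>U\<close> and \<open>V\<close> reverses exactly the
      entries of the cut. None of them is positive, so no entry decreases, and the negative entry at
      \<open>x0\<close>, \<open>y0\<close> disappears.\<close>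
    define \<theta>' where "\<theta>' x = (if x \<in> U then - \<theta> x else \<theta> x)" for x
    define \<eta>' where "\<eta>' y = (if y \<in> V then - \<eta> y else \<eta> y)" for y
    have rs: "resign \<theta>' \<eta>' w x y = (if (x \<in> U) \<noteq> (y \<in> V) then - resign \<theta> \<eta> w x y else resign \<theta> \<eta> w x y)" for x y
      by (simp add: resign_def \<theta>'_def \<eta>'_def)
    have mono: "resign \<theta> \<eta> w x y \<le> resign \<theta>' \<eta>' w x y" if "x \<in> X" "y \<in> Y" for x y
      using npos[OF that] by (auto simp: rs)
    have "bil X Y w f g \<le> bil X Y (resign \<theta>' \<eta>' w) (\<lambda>x. \<bar>f x\<bar>) (\<lambda>y. \<bar>g y\<bar>)"
      by (rule order_trans[OF S(3) bil_mono]) (use mono in auto)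
    moreover have "is_signing \<theta>'" "is_signing \<eta>'"
      using S(1,2) by (auto simp: is_signing_def \<theta>'_def \<eta>'_def)
    ultimately have "S (\<theta>', \<eta>')" by (simp add: S_def)
    then have "card (neg z) \<le> card (neg (\<theta>', \<eta>'))" by (rule min)
    moreover have "card (neg (\<theta>', \<eta>')) < card (neg z)"
    proof (rule psubset_card_mono)
      have "neg z \<subseteq> X \<times> Y" by (auto simp: neg_def z)
      then show "finite (neg z)" using fin by (meson finite_SigmaI finite_subset)
      have "neg (\<theta>', \<eta>') \<subseteq> neg z" using mono by (fastforce simp: neg_def z)
      moreover have "(x0, y0) \<in> neg z - neg (\<theta>', \<eta>')" using xy by (auto simp: neg_def z rs)
      ultimately show "neg (\<theta>', \<eta>') \<subset> neg z" by blast
    qed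
    ultimately show False by simp
  qed
  then show ?thesis using that[OF S] by blast
qed

text \<open>\<open>quad\<close> excludes negative 4-cycles, its degenerate instances being squares.
  \<open>unbal\<close> is the switching form of imbalance: no switching removes all negative
  edges.\<close>

locale unbalanced_array =
  fixes X :: "'a set" and Y :: "'b set" and w :: "'a \<Rightarrow> 'b \<Rightarrow> real"
  assumes fin: "finite X" "finite Y"
    and entries: "x \<in> X \<Longrightarrow> y \<in> Y \<Longrightarrow> w x y \<in> {-1, 0, 1}"
    and quad: "x \<in> X \<Longrightarrow> x' \<in> X \<Longrightarrow> y \<in> Y \<Longrightarrow> y' \<in> Y \<Longrightarrow>
      0 \<le> w x y * w x y' * w x' y * w x' y'"
    and unbal: "is_signing \<theta> \<Longrightarrow> is_signing \<eta> \<Longrightarrow> \<exists>x\<in>X. \<exists>y\<in>Y. resign \<theta> \<eta> w x y < 0"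
begin

lemma hex_majorant:
  obtains \<theta> \<eta> P Q u v where "is_signing \<theta>" "is_signing \<eta>"
    "bil X Y w f g \<le> bil X Y (resign \<theta> \<eta> w) (\<lambda>x. \<bar>f x\<bar>) (\<lambda>y. \<bar>g y\<bar>)"
    "hex_blowup X P Y Q u v"
    "\<And>x y. x \<in> X \<Longrightarrow> y \<in> Y \<Longrightarrow> resign \<theta> \<eta> w x y \<le> hexsign P Q u v x y"
proof -
  obtain \<theta> \<eta> where s: "is_signing \<theta>" "is_signing \<eta>"
    and le: "bil X Y w f g \<le> bil X Y (resign \<theta> \<eta> w) (\<lambda>x. \<bar>f x\<bar>) (\<lambda>y. \<bar>g y\<bar>)"
    and cut: "\<And>U V x y. x \<in> X \<Longrightarrow> y \<in> Y \<Longrightarrow> (x \<in> U) \<noteq> (y \<in> V) \<Longrightarrow> resign \<theta> \<eta> w x y < 0 \<Longrightarrow>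
      \<exists>x\<in>X. \<exists>y\<in>Y. (x \<in> U) \<noteq> (y \<in> V) \<and> resign \<theta> \<eta> w x y > 0"
    using minimal_resigning[OF fin, of w f g] by blast
  define W where "W = resign \<theta> \<eta> w"
  note cut = cut[folded W_def]
  have W: "W x y \<in> {-1, 0, 1}" if "x \<in> X" "y \<in> Y" for x y
  proof -
    have "\<theta> x = 1 \<or> \<theta> x = -1" "\<eta> y = 1 \<or> \<eta> y = -1" using s by (auto simp: is_signing_def)
    then show ?thesis using entries[OF that] by (auto simp: W_def resign_def)
  qed
  have quadW: "0 \<le> W x y * W x y' * W x' y * W x' y'"
    if "x \<in> X" "x' \<in> X" "y \<in> Y" "y' \<in> Y" for x x' y y'
  proof -
    have "W x y * W x y' * W x' y * W x' y' = (\<theta> x * \<theta> x) * (\<theta> x' * \<theta> x') * (\<eta> y * \<eta> y) * (\<eta> y' * \<eta> y')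
        * (w x y * w x y' * w x' y * w x' y')"
      by (simp only: W_def resign_def mult_ac)
    then show ?thesis using quad[OF that] by (simp add: is_signing_sq s)
  qed
  obtain u v where uv: "u \<in> X" "v \<in> Y" "W u v < 0"
    using unbal[OF s] by (auto simp: W_def)
  define P where "P = {x\<in>X. W x v > 0}"
  define Q where "Q = {y\<in>Y. W u y > 0}"
  have uP: "u \<notin> P" and vQ: "v \<notin> Q" using uv by (auto simp: P_def Q_def)
  \<comment> \<open>A positive entry here would close the negative 4-cycle \<open>x\<close>,
    \<open>v\<close>, \<open>u\<close>, \<open>y\<close>.\<close>
  have PQ: "W x y \<le> 0" if "x \<in> P" "y \<in> Q" for x y
  proof (rule ccontr)
    assume "\<not> W x y \<le> 0"
    moreover have "W x v > 0" "W u y > 0" using that by (auto simp: P_def Q_def)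
    ultimately have "W x y * W x v * W u y * W u v < 0"
      using uv(3) by (intro mult_pos_neg mult_pos_pos) simp_all
    then show False using quadW[of x u y v] that uv by (auto simp: P_def Q_def)
  qed
  \<comment> \<open>The cut around \<open>v\<close> is the column of \<open>v\<close>, so its
    positive entry lies over \<open>P\<close>; the row of \<open>u\<close> yields \<open>Q\<close>
    in the same way.\<close>
  have "P \<noteq> {}"
    using cut[of u v "{}" "{v}"] uv by (auto simp: P_def)
  moreover have "Q \<noteq> {}"
    using cut[of u v "{u}" "{}"] uv by (auto simp: Q_def)
  moreover have "X - {u} - P \<noteq> {}"
  proof
    assume e: "X - {u} - P = {}"
    \<comment> \<open>In this cut the row of \<open>u\<close> contributes only entries outside
      \<open>Q\<close>, none of them positive. Hence \<open>x \<noteq> u\<close> and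
      \<open>y \<in> Q\<close>, and if the class were empty, \<open>x\<close> would lie in
      \<open>P\<close>, against \<open>PQ\<close>.\<close>
    obtain x y where xy: "x \<in> X" "y \<in> Y" "(x \<in> {u}) \<noteq> (y \<in> Q)" "W x y > 0"
      using cut[of u v "{u}" Q] uv vQ by auto
    then have "x \<noteq> u" by (auto simp: Q_def)
    then have "x \<in> P" "y \<in> Q" using xy e by auto
    then show False using PQ[of x y] xy by simp
  qed
  moreover have "Y - {v} - Q \<noteq> {}"
  proof
    assume e: "Y - {v} - Q = {}"
    obtain x y where xy: "x \<in> X" "y \<in> Y" "(x \<in> P) \<noteq> (y \<in> {v})" "W x y > 0"
      using cut[of u v P "{v}"] uv uP by auto
    then have "y \<noteq> v" by (auto simp: P_def)
    then have "x \<in> P" "y \<in> Q" using xy e by auto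
    then show False using PQ[of x y] xy by simp
  qed
  ultimately have "hex_blowup X P Y Q u v"
    using fin uv uP vQ by unfold_locales (auto simp: P_def Q_def)
  \<comment> \<open>All entries are at most 1, so only the places with a smaller
    \<open>hexsign\<close> matter: \<open>u v\<close> itself, the row of \<open>u\<close> off
    \<open>Q\<close>, the column of \<open>v\<close> off \<open>P\<close>, and \<open>P\<close>
    against \<open>Q\<close>.\<close>
  moreover have "W x y \<le> hexsign P Q u v x y" if "x \<in> X" "y \<in> Y" for x y
    using W[OF that] PQ[of x y] uv that unfolding hexsign_def
    by (auto simp: P_def Q_def)
  ultimately show ?thesis using that[OF s le] unfolding W_def by blast
qed

section \<open>The bound for unbalanced arrays and its extremal arrays\<close>

abbreviation "\<beta> \<equiv> sqrt (beta_sq (real (card X) - 1) (real (card Y) - 1))"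

lemma bil_le: "2 * bil X Y w f g \<le> \<beta> * (sqn X f + sqn Y g)"
proof -
  obtain \<theta> \<eta> P Q u v where "is_signing \<theta>" "is_signing \<eta>"
    and le: "bil X Y w f g \<le> bil X Y (resign \<theta> \<eta> w) (\<lambda>x. \<bar>f x\<bar>) (\<lambda>y. \<bar>g y\<bar>)"
    and hex: "hex_blowup X P Y Q u v"
    and maj: "\<And>x y. x \<in> X \<Longrightarrow> y \<in> Y \<Longrightarrow> resign \<theta> \<eta> w x y \<le> hexsign P Q u v x y"
    by (rule hex_majorant[of f g]) (rule that)
  have "bil X Y w f g \<le> bil X Y (hexsign P Q u v) (\<lambda>x. \<bar>f x\<bar>) (\<lambda>y. \<bar>g y\<bar>)"
    by (rule order_trans[OF le bil_mono[OF maj]]) auto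
  then show ?thesis
    using hex_blowup.hexsign_bound[OF hex, of "\<lambda>x. \<bar>f x\<bar>" "\<lambda>y. \<bar>g y\<bar>"] by simp
qed

text \<open>The signs are absorbed into the vectors without changing the norms. Thus
  \<open>bil_max_eigen\<close> also applies to the switched array.\<close>

lemma resign_bil_le:
  assumes "is_signing \<theta>" "is_signing \<eta>"
  shows "2 * bil X Y (resign \<theta> \<eta> w) f g \<le> \<beta> * (sqn X f + sqn Y g)"
proof -
  have "bil X Y (resign \<theta> \<eta> w) f g = bil X Y w (\<lambda>x. \<theta> x * f x) (\<lambda>y. \<eta> y * g y)"
    by (simp add: bil_def resign_def mult_ac)
  moreover have "sqn X (\<lambda>x. \<theta> x * f x) = sqn X f" "sqn Y (\<lambda>y. \<eta> y * g y) = sqn Y g"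
    using assms by (simp_all add: sqn_def power_mult_distrib power2_eq_square[of "\<theta> _"]
        power2_eq_square[of "\<eta> _"] is_signing_sq)
  ultimately show ?thesis using bil_le[of "\<lambda>x. \<theta> x * f x" "\<lambda>y. \<eta> y * g y"] by simp
qed

text \<open>Equality squeezes the switched array and its majorant to the same value at the absolute
  vectors, which are therefore eigenvectors of both. The difference of the two arrays has
  nonnegative entries and annihilates them, so an entry where they differ needs
  \<open>F x = 0\<close> and \<open>G y = 0\<close>. Positivity leaves only \<open>u\<close>,
  \<open>v\<close>, where one value is positive.\<close>

lemma majorant_eq:
  assumes eq: "2 * bil X Y w f g = \<beta> * (sqn X f + sqn Y g)"
    and nz: "sqn X f + sqn Y g \<noteq> 0"
  obtains \<theta> \<eta> P Q u v where "is_signing \<theta>" "is_signing \<eta>" "hex_blowup X P Y Q u v"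
    "\<And>x y. x \<in> X \<Longrightarrow> y \<in> Y \<Longrightarrow> resign \<theta> \<eta> w x y = hexsign P Q u v x y"
    "card P = 1 \<or> card Q = 1" "card P = 1 \<or> card (X - {u} - P) = 1"
    "card Q = 1 \<or> card (Y - {v} - Q) = 1"
proof -
  obtain \<theta> \<eta> P Q u v where s: "is_signing \<theta>" "is_signing \<eta>" and
    le: "bil X Y w f g \<le> bil X Y (resign \<theta> \<eta> w) (\<lambda>x. \<bar>f x\<bar>) (\<lambda>y. \<bar>g y\<bar>)"
    and hex: "hex_blowup X P Y Q u v"
    and maj: "\<And>x y. x \<in> X \<Longrightarrow> y \<in> Y \<Longrightarrow> resign \<theta> \<eta> w x y \<le> hexsign P Q u v x y"
    by (rule hex_majorant[of f g]) (rule that)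
  interpret hex_blowup X P Y Q u v by (rule hex)
  define W where "W = resign \<theta> \<eta> w"
  define H where "H = hexsign P Q u v"
  define F where "F = (\<lambda>x. \<bar>f x\<bar>)"
  define G where "G = (\<lambda>y. \<bar>g y\<bar>)"
  have WH: "W x y \<le> H x y" if "x \<in> X" "y \<in> Y" for x y
    using maj[OF that] by (simp add: W_def H_def)
  have sq: "sqn X F = sqn X f" "sqn Y G = sqn Y g" by (simp_all add: F_def G_def)
  have leW: "2 * bil X Y W f g \<le> \<beta> * (sqn X f + sqn Y g)" for f g
    unfolding W_def by (rule resign_bil_le[OF s])
  have leW': "2 * bil Y X (\<lambda>y x. W x y) g f \<le> \<beta> * (sqn Y g + sqn X f)" for f g
    using leW[of f g] by (simp add: bil_swap[of X] add.commute)
  have "bil X Y W F G \<le> bil X Y H F G"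
    by (rule bil_mono[OF WH]) (auto simp: F_def G_def)
  moreover have "bil X Y w f g \<le> bil X Y W F G" using le by (simp add: W_def F_def G_def)
  moreover have "2 * bil X Y H F G \<le> \<beta> * (sqn X F + sqn Y G)"
    unfolding H_def by (rule hexsign_bound)
  ultimately have eqW: "2 * bil X Y W F G = \<beta> * (sqn X F + sqn Y G)"
    and eqH: "2 * bil X Y H F G = \<beta> * (sqn X F + sqn Y G)"
    using eq unfolding sq by linarith+
  have FG: "\<forall>x\<in>X. F x \<ge> 0" "\<forall>y\<in>Y. G y \<ge> 0" by (auto simp: F_def G_def)
  note H = hexsign_equality[OF eqH[unfolded H_def] FG nz[folded sq]]
  note eH = hexsign_eigen[OF eqH[unfolded H_def], folded H_def]
  have eX: "(\<Sum>y\<in>Y. W x y * G y) = \<beta> * F x" if "x \<in> X" for x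
    by (rule bil_max_eigen[OF fin(1) t_pos(2) leW eqW that])
  have eY: "(\<Sum>x\<in>X. W x y * F x) = \<beta> * G y" if "y \<in> Y" for y
    by (rule bil_max_eigen[OF fin(2) t_pos(2) leW' _ that])
      (use eqW in \<open>simp add: bil_swap[of X] add.commute\<close>)
  have "W x y = H x y" if xy: "x \<in> X" "y \<in> Y" for x y
  proof (rule ccontr)
    assume "W x y \<noteq> H x y"
    then have lt: "H x y - W x y > 0" using WH[OF xy] by simp
    have "(\<Sum>y\<in>Y. (H x y - W x y) * G y) = 0"
      using eX[OF xy(1)] eH(1)[OF xy(1)] by (simp add: left_diff_distrib sum_subtractf)
    then have "(H x y - W x y) * G y = 0"
      using sum_nonneg_eq_0_iff[of Y "\<lambda>y. (H x y - W x y) * G y"] WH[OF xy(1)] FG(2) xy(2) fin(2)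
      by simp
    then have Gy: "G y = 0" using lt by simp
    have "(\<Sum>x\<in>X. (H x y - W x y) * F x) = 0"
      using eY[OF xy(2)] eH(2)[OF xy(2)] by (simp add: left_diff_distrib sum_subtractf)
    then have "(H x y - W x y) * F x = 0"
      using sum_nonneg_eq_0_iff[of X "\<lambda>x. (H x y - W x y) * F x"] WH[OF _ xy(2)] FG(1) xy(1) fin(1)
      by simp
    then have Fx: "F x = 0" using lt by simp
    have "x = u" "y = v" using H(1)[OF xy(1)] H(2)[OF xy(2)] Fx Gy by auto
    then show False using H(3) Fx Gy by simp
  qed
  then show ?thesis
    using that[OF s hex] H(4) unfolding W_def H_def by simp
qed

text \<open>The size conditions leave four consecutive singleton classes in the hexagon. Switching
  at one vertex, where necessary, moves the negative edge to the middle of these four.\<close>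

lemma bil_extremal:
  assumes eq: "2 * bil X Y w f g = \<beta> * (sqn X f + sqn Y g)"
    and nz: "sqn X f + sqn Y g \<noteq> 0"
  obtains \<theta> \<eta> x1 x2 y1 y2 where "is_signing \<theta>" "is_signing \<eta>"
    "x1 \<in> X" "x2 \<in> X" "x1 \<noteq> x2" "y1 \<in> Y" "y2 \<in> Y" "y1 \<noteq> y2"
    "\<And>x y. x \<in> X \<Longrightarrow> y \<in> Y \<Longrightarrow> resign \<theta> \<eta> w x y = hexsign {x2} {y2} x1 y1 x y"
proof -
  obtain \<theta> \<eta> P Q u v where s: "is_signing \<theta>" "is_signing \<eta>" and hex: "hex_blowup X P Y Q u v"
    and W: "\<And>x y. x \<in> X \<Longrightarrow> y \<in> Y \<Longrightarrow> resign \<theta> \<eta> w x y = hexsign P Q u v x y"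
    and c: "card P = 1 \<or> card Q = 1" "card P = 1 \<or> card (X - {u} - P) = 1"
    "card Q = 1 \<or> card (Y - {v} - Q) = 1"
    by (rule majorant_eq[OF assms]) (rule that)
  interpret hex_blowup X P Y Q u v by (rule hex)
  consider "card P = 1" "card Q = 1" | "card P = 1" "card (Y - {v} - Q) = 1"
    | "card Q = 1" "card (X - {u} - P) = 1"
    using c by auto
  then show ?thesis
  proof cases
    case 1
    then obtain a b where "P = {a}" "Q = {b}" by (auto simp: card_1_singleton_iff)
    then show ?thesis using that[OF s, of u a v b] W u v by auto
  next
    case 2
    \<comment> \<open>The singletons are \<open>u\<close>, \<open>v\<close>, \<open>a\<close>,
      \<open>b\<close> in this order; switching at \<open>v\<close> moves the negative edge from
      \<open>u v\<close> to \<open>v a\<close>.\<close>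
    then obtain a b where P: "P = {a}" and Q: "Y - {v} - Q = {b}" by (auto simp: card_1_singleton_iff)
    have sg: "is_signing (\<lambda>y. if y = v then - \<eta> y else \<eta> y)" using s by (auto simp: is_signing_def)
    have rs: "resign \<theta> (\<lambda>y. if y = v then - \<eta> y else \<eta> y) w x y = hexsign {u} {b} a v x y"
      if "x \<in> X" "y \<in> Y" for x y
    proof -
      have "resign \<theta> (\<lambda>y. if y = v then - \<eta> y else \<eta> y) w x y
          = (if y = v then - hexsign P Q u v x y else hexsign P Q u v x y)"
        using W[OF that] by (cases "y = v") (auto simp: resign_def)
      moreover have "y \<in> Q \<longleftrightarrow> y \<noteq> v \<and> y \<noteq> b" "b \<noteq> v" "a \<noteq> u" using Q P v u that by auto
      ultimately show ?thesis by (auto simp: hexsign_def P)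
    qed
    have "a \<in> X" "b \<in> Y" "a \<noteq> u" "v \<noteq> b" using u v P Q by blast+
    then show ?thesis using u v rs by (intro that[OF s(1) sg, of a u v b]) auto
  next
    case 3
    \<comment> \<open>The singletons are \<open>b\<close>, \<open>a\<close>, \<open>u\<close>,
      \<open>v\<close> in this order; switching at \<open>u\<close> moves the negative edge to
      \<open>a u\<close>.\<close>
    then obtain a b where Q: "Q = {a}" and P: "X - {u} - P = {b}" by (auto simp: card_1_singleton_iff)
    have sg: "is_signing (\<lambda>x. if x = u then - \<theta> x else \<theta> x)" using s by (auto simp: is_signing_def)
    have rs: "resign (\<lambda>x. if x = u then - \<theta> x else \<theta> x) \<eta> w x y = hexsign {b} {v} u a x y"
      if "x \<in> X" "y \<in> Y" for x y
    proof -
      have "resign (\<lambda>x. if x = u then - \<theta> x else \<theta> x) \<eta> w x y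
          = (if x = u then - hexsign P Q u v x y else hexsign P Q u v x y)"
        using W[OF that] by (cases "x = u") (auto simp: resign_def)
      moreover have "x \<in> P \<longleftrightarrow> x \<noteq> u \<and> x \<noteq> b" "b \<noteq> u" "a \<noteq> v" using Q P v u that by auto
      ultimately show ?thesis by (auto simp: hexsign_def Q)
    qed
    have "a \<in> Y" "b \<in> X" "a \<noteq> v" "u \<noteq> b" using u v P Q by blast+
    then show ?thesis using u v rs by (intro that[OF sg s(2), of u b a v]) auto
  qed
qed

end

section \<open>Spectral radius of bipartite signed graphs\<close>

lemma adj_commute: "adj \<Gamma> x y = adj \<Gamma> y x"
  by (simp add: adj_def insert_commute)

lemma vertex_list:
  assumes "signed_graph \<Gamma>"
  shows "bij_betw ((!) (vertex_list \<Gamma>)) {..<card (verts \<Gamma>)} (verts \<Gamma>)"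
proof -
  have "\<exists>vs. distinct vs \<and> set vs = verts \<Gamma>"
    using assms finite_distinct_list[of "verts \<Gamma>"] by (auto simp: signed_graph_def)
  then have "distinct (vertex_list \<Gamma>) \<and> set (vertex_list \<Gamma>) = verts \<Gamma>"
    unfolding vertex_list_def by (rule someI_ex)
  then have vs: "distinct (vertex_list \<Gamma>)" "set (vertex_list \<Gamma>) = verts \<Gamma>" by auto
  then have "length (vertex_list \<Gamma>) = card (verts \<Gamma>)" by (metis distinct_card)
  then show ?thesis using bij_betw_nth[OF vs(1)] vs(2) by simp
qed

lemma adj_matrix_carrier: "adj_matrix \<Gamma> \<in> carrier_mat (card (verts \<Gamma>)) (card (verts \<Gamma>))"
  by (simp add: adj_matrix_def Let_def)

lemma adj_matrix_mult_index:
  assumes G: "signed_graph \<Gamma>" and i: "i < card (verts \<Gamma>)"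
    and v: "v = vec (card (verts \<Gamma>)) (\<lambda>j. c (vertex_list \<Gamma> ! j))"
  shows "(adj_matrix \<Gamma> *\<^sub>v v) $ i = (\<Sum>y\<in>verts \<Gamma>. of_int (adj \<Gamma> (vertex_list \<Gamma> ! i) y) * c y)"
proof -
  have "(\<Sum>y\<in>verts \<Gamma>. of_int (adj \<Gamma> (vertex_list \<Gamma> ! i) y) * c y)
      = (\<Sum>j\<in>{..<card (verts \<Gamma>)}. of_int (adj \<Gamma> (vertex_list \<Gamma> ! i) (vertex_list \<Gamma> ! j)) * c (vertex_list \<Gamma> ! j))"
    by (rule sum.reindex_bij_betw[OF vertex_list[OF G], symmetric])
  then show ?thesis
    using i by (simp add: adj_matrix_def Let_def v scalar_prod_def atLeast0LessThan)
qed

text \<open>Removes the chosen enumeration: eigenvectors become functions on the vertices.\<close>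

lemma eigenvalue_adj_matrix_iff:
  assumes G: "signed_graph \<Gamma>"
  shows "eigenvalue (adj_matrix \<Gamma>) \<mu> \<longleftrightarrow> (\<exists>c. (\<exists>x\<in>verts \<Gamma>. c x \<noteq> 0) \<and>
    (\<forall>x\<in>verts \<Gamma>. (\<Sum>y\<in>verts \<Gamma>. of_int (adj \<Gamma> x y) * c y) = \<mu> * c x))"
proof
  let ?n = "card (verts \<Gamma>)" and ?vs = "vertex_list \<Gamma>"
  note bij = vertex_list[OF G]
  have dim: "dim_row (adj_matrix \<Gamma>) = ?n" using adj_matrix_carrier by blast
  have vs: "?vs ! i \<in> verts \<Gamma>" if "i < ?n" for i
    using bij_betw_apply[OF bij, of i] that by simp
  have surj: "\<exists>i<?n. x = ?vs ! i" if "x \<in> verts \<Gamma>" for x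
  proof -
    have "x \<in> (!) ?vs ` {..<?n}" using that bij_betw_imp_surj_on[OF bij] by (simp only:)
    then show ?thesis by blast
  qed
  {
    assume "eigenvalue (adj_matrix \<Gamma>) \<mu>"
    then obtain z where z: "z \<in> carrier_vec ?n" "z \<noteq> 0\<^sub>v ?n" "adj_matrix \<Gamma> *\<^sub>v z = \<mu> \<cdot>\<^sub>v z"
      by (auto simp: eigenvalue_def eigenvector_def dim)
    define c where "c x = z $ (inv_into {..<?n} ((!) ?vs) x)" for x
    have c: "c (?vs ! j) = z $ j" if "j < ?n" for j
      using bij that by (simp add: c_def bij_betw_inv_into_left)
    then have zc: "z = vec ?n (\<lambda>j. c (?vs ! j))" using z(1) by (intro eq_vecI) auto
    have "\<exists>j<?n. z $ j \<noteq> 0"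
    proof (rule ccontr)
      assume "\<not> ?thesis"
      then have "z = 0\<^sub>v ?n" using z(1) by (intro eq_vecI) auto
      then show False using z(2) by simp
    qed
    then obtain j where j: "j < ?n" "z $ j \<noteq> 0" by blast
    then have "c (?vs ! j) \<noteq> 0" using c by simp
    then have "\<exists>x\<in>verts \<Gamma>. c x \<noteq> 0" using vs[OF j(1)] by blast
    moreover have "(\<Sum>y\<in>verts \<Gamma>. of_int (adj \<Gamma> x y) * c y) = \<mu> * c x" if x: "x \<in> verts \<Gamma>" for x
    proof -
      obtain i where i: "i < ?n" "x = ?vs ! i" using surj[OF x] by blast
      then show ?thesis
        using adj_matrix_mult_index[OF G i(1) zc] z c by simp
    qed
    ultimately show "\<exists>c. (\<exists>x\<in>verts \<Gamma>. c x \<noteq> 0) \<and>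
        (\<forall>x\<in>verts \<Gamma>. (\<Sum>y\<in>verts \<Gamma>. of_int (adj \<Gamma> x y) * c y) = \<mu> * c x)" by blast
  }
  assume "\<exists>c. (\<exists>x\<in>verts \<Gamma>. c x \<noteq> 0) \<and>
      (\<forall>x\<in>verts \<Gamma>. (\<Sum>y\<in>verts \<Gamma>. of_int (adj \<Gamma> x y) * c y) = \<mu> * c x)"
  then obtain c x where x: "x \<in> verts \<Gamma>" "c x \<noteq> 0"
    and c: "\<And>x. x \<in> verts \<Gamma> \<Longrightarrow> (\<Sum>y\<in>verts \<Gamma>. of_int (adj \<Gamma> x y) * c y) = \<mu> * c x" by blast
  define z where "z = vec ?n (\<lambda>j. c (?vs ! j))"
  obtain i where i: "i < ?n" "x = ?vs ! i" using surj[OF x(1)] by blast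
  then have "z $ i \<noteq> 0" using x by (simp add: z_def)
  then have "z \<noteq> 0\<^sub>v ?n" using i by auto
  moreover have "adj_matrix \<Gamma> *\<^sub>v z = \<mu> \<cdot>\<^sub>v z"
  proof (rule eq_vecI)
    fix i assume "i < dim_vec (\<mu> \<cdot>\<^sub>v z)"
    then have i: "i < ?n" by (simp add: z_def)
    show "(adj_matrix \<Gamma> *\<^sub>v z) $ i = (\<mu> \<cdot>\<^sub>v z) $ i"
      using adj_matrix_mult_index[OF G i z_def] c[OF vs[OF i]] i by (simp add: z_def)
  qed (simp add: z_def dim)
  moreover have "z \<in> carrier_vec ?n" by (simp add: z_def)
  ultimately show "eigenvalue (adj_matrix \<Gamma>) \<mu>"
    unfolding eigenvalue_def eigenvector_def dim by blast
qed

text \<open>The radius is used only through being attained, as here, and through dominating all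
  eigenvalues, as in \<open>norm_le_sg_radius\<close>.\<close>

lemma sg_radius_eigenvector:
  assumes G: "signed_graph \<Gamma>" and ne: "verts \<Gamma> \<noteq> {}"
  obtains \<mu> :: complex and c :: "'a \<Rightarrow> complex" and x where "norm \<mu> = sg_radius \<Gamma>" "x \<in> verts \<Gamma>" "c x \<noteq> 0"
    "\<And>x. x \<in> verts \<Gamma> \<Longrightarrow> (\<Sum>y\<in>verts \<Gamma>. of_int (adj \<Gamma> x y) * c y) = \<mu> * c x"
proof -
  have "card (verts \<Gamma>) > 0" using G ne by (simp add: signed_graph_def card_gt_0_iff)
  from spectral_radius_mem_max(1)[OF adj_matrix_carrier this]
  obtain \<mu> where "eigenvalue (adj_matrix \<Gamma>) \<mu>" "norm \<mu> = sg_radius \<Gamma>"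
    by (auto simp: sg_radius_def spectrum_def)
  then obtain c x where "x \<in> verts \<Gamma>" "c x \<noteq> 0"
    "\<And>x. x \<in> verts \<Gamma> \<Longrightarrow> (\<Sum>y\<in>verts \<Gamma>. of_int (adj \<Gamma> x y) * c y) = \<mu> * c x"
    unfolding eigenvalue_adj_matrix_iff[OF G] by blast
  then show ?thesis by (rule that[OF \<open>norm \<mu> = sg_radius \<Gamma>\<close>])
qed

lemma norm_le_sg_radius:
  fixes c :: "'a \<Rightarrow> complex" and \<mu> :: complex
  assumes G: "signed_graph \<Gamma>" and x: "x \<in> verts \<Gamma>" "c x \<noteq> 0"
    and c: "\<And>x. x \<in> verts \<Gamma> \<Longrightarrow> (\<Sum>y\<in>verts \<Gamma>. of_int (adj \<Gamma> x y) * c y) = \<mu> * c x"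
  shows "norm \<mu> \<le> sg_radius \<Gamma>"
proof -
  have "eigenvalue (adj_matrix \<Gamma>) \<mu>" unfolding eigenvalue_adj_matrix_iff[OF G] using x c by blast
  moreover have "card (verts \<Gamma>) > 0" using G x by (auto simp: signed_graph_def card_gt_0_iff)
  ultimately show ?thesis
    using spectral_radius_mem_max(2)[OF adj_matrix_carrier] by (auto simp: sg_radius_def spectrum_def)
qed

lemma bipartition_verts:
  assumes "signed_graph \<Gamma>" "bipartition \<Gamma> X Y"
  shows "verts \<Gamma> = X \<union> Y" "X \<inter> Y = {}" "finite X" "finite Y"
  using assms finite_subset[of _ "verts \<Gamma>"] by (auto simp: bipartition_def signed_graph_def)

lemma bipartition_edge:
  assumes "bipartition \<Gamma> X Y" "{x, y} \<in> edges \<Gamma>"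
  shows "x \<in> X \<and> y \<in> Y \<or> x \<in> Y \<and> y \<in> X"
proof -
  have "\<exists>a\<in>X. \<exists>b\<in>Y. {x, y} = {a, b}"
    using assms unfolding bipartition_def by (elim conjE) (erule bspec)
  then obtain a b where "a \<in> X" "b \<in> Y" "{x, y} = {a, b}" by (elim bexE)
  then show ?thesis unfolding doubleton_eq_iff by (elim disjE conjE) simp_all
qed

lemma adj_same_part:
  assumes "bipartition \<Gamma> X Y"
  shows "x \<in> X \<Longrightarrow> y \<in> X \<Longrightarrow> adj \<Gamma> x y = 0" "x \<in> Y \<Longrightarrow> y \<in> Y \<Longrightarrow> adj \<Gamma> x y = 0"
proof -
  have "X \<inter> Y = {}" using assms by (simp add: bipartition_def)
  then have "{x, y} \<notin> edges \<Gamma>" if "x \<in> X \<and> y \<in> X \<or> x \<in> Y \<and> y \<in> Y"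
    using bipartition_edge[OF assms, of x y] that by auto
  then show "x \<in> X \<Longrightarrow> y \<in> X \<Longrightarrow> adj \<Gamma> x y = 0" "x \<in> Y \<Longrightarrow> y \<in> Y \<Longrightarrow> adj \<Gamma> x y = 0"
    by (simp_all add: adj_def)
qed

lemma sum_adj:
  fixes c :: "'a \<Rightarrow> 'b::comm_ring_1"
  assumes G: "signed_graph \<Gamma>" "bipartition \<Gamma> X Y"
  shows "x \<in> X \<Longrightarrow> (\<Sum>y\<in>verts \<Gamma>. of_int (adj \<Gamma> x y) * c y) = (\<Sum>y\<in>Y. of_int (adj \<Gamma> x y) * c y)"
    and "y \<in> Y \<Longrightarrow> (\<Sum>x\<in>verts \<Gamma>. of_int (adj \<Gamma> y x) * c x) = (\<Sum>x\<in>X. of_int (adj \<Gamma> x y) * c x)"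
proof -
  note V = bipartition_verts[OF G] and A = adj_same_part[OF G(2)]
  show "x \<in> X \<Longrightarrow> (\<Sum>y\<in>verts \<Gamma>. of_int (adj \<Gamma> x y) * c y) = (\<Sum>y\<in>Y. of_int (adj \<Gamma> x y) * c y)"
    unfolding V(1) using V A by (subst sum.union_disjoint) auto
  show "y \<in> Y \<Longrightarrow> (\<Sum>x\<in>verts \<Gamma>. of_int (adj \<Gamma> y x) * c x) = (\<Sum>x\<in>X. of_int (adj \<Gamma> x y) * c x)"
    unfolding V(1) using V A by (subst sum.union_disjoint) (auto simp: adj_commute[of _ y])
qed

text \<open>Multiplying the \<open>Y\<close>-part of a complex eigenvector by a suitable unit makes the two
  off-diagonal parts of the Hermitian form real; then its real and imaginary parts are taken.\<close>

lemma sg_radius_real_vectors: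
  assumes G: "signed_graph \<Gamma>" "bipartition \<Gamma> X Y" and ne: "verts \<Gamma> \<noteq> {}"
  defines "w \<equiv> \<lambda>x y. real_of_int (adj \<Gamma> x y)"
  obtains f g h k where
    "2 * bil X Y w f g + 2 * bil X Y w h k = sg_radius \<Gamma> * ((sqn X f + sqn Y g) + (sqn X h + sqn Y k))"
    "(sqn X f + sqn Y g) + (sqn X h + sqn Y k) > 0"
proof -
  note V = bipartition_verts[OF G]
  obtain \<mu> :: complex and c :: "'a \<Rightarrow> complex" and x0 where mu: "norm \<mu> = sg_radius \<Gamma>" and x0: "x0 \<in> verts \<Gamma>" "c x0 \<noteq> 0"
    and c: "\<And>x. x \<in> verts \<Gamma> \<Longrightarrow> (\<Sum>y\<in>verts \<Gamma>. of_int (adj \<Gamma> x y) * c y) = \<mu> * c x"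
    by (rule sg_radius_eigenvector[OF G(1) ne]) (rule that)
  define N where "N A = (\<Sum>x\<in>A. (norm (c x))\<^sup>2)" for A
  have N0: "N A \<ge> 0" for A by (simp add: N_def sum_nonneg)
  \<comment> \<open>One off-diagonal part of the Hermitian form. Evaluated by rows it has modulus
    \<open>sg_radius \<Gamma> * N X\<close>, by columns \<open>sg_radius \<Gamma> * N Y\<close>;
    only the modulus of \<open>\<mu>\<close> enters.\<close>
  define S where "S = (\<Sum>x\<in>X. \<Sum>y\<in>Y. of_real (w x y) * c y * cnj (c x))"
  have cc: "c x * cnj (c x) = of_real ((norm (c x))\<^sup>2)" for x
    by (rule complex_norm_square[symmetric])
  have "S = (\<Sum>x\<in>X. (\<Sum>y\<in>Y. of_int (adj \<Gamma> x y) * c y) * cnj (c x))"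
    by (simp add: S_def w_def sum_distrib_right)
  also have "\<dots> = (\<Sum>x\<in>X. \<mu> * of_real ((norm (c x))\<^sup>2))"
    using c V(1) by (intro sum.cong) (simp_all add: sum_adj(1)[OF G, symmetric] mult.assoc cc)
  also have "\<dots> = \<mu> * of_real (N X)" by (simp add: N_def sum_distrib_left)
  finally have SX: "norm S = sg_radius \<Gamma> * N X"
    by (simp add: norm_mult mu N0)
  have "cnj S = (\<Sum>y\<in>Y. \<Sum>x\<in>X. of_int (adj \<Gamma> x y) * c x * cnj (c y))"
    unfolding S_def w_def by (subst sum.swap) (simp add: mult_ac)
  also have "\<dots> = (\<Sum>y\<in>Y. (\<Sum>x\<in>X. of_int (adj \<Gamma> x y) * c x) * cnj (c y))"
    by (simp add: sum_distrib_right)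
  also have "\<dots> = (\<Sum>y\<in>Y. \<mu> * of_real ((norm (c y))\<^sup>2))"
    using c V(1) by (intro sum.cong) (simp_all add: sum_adj(2)[OF G, symmetric] mult.assoc cc)
  also have "\<dots> = \<mu> * of_real (N Y)" by (simp add: N_def sum_distrib_left)
  finally have "norm (cnj S) = sg_radius \<Gamma> * N Y"
    by (simp add: norm_mult mu N0 del: complex_mod_cnj)
  then have SY: "norm S = sg_radius \<Gamma> * N Y" by simp
  obtain \<omega> where om: "norm \<omega> = 1" "\<omega> * S = of_real (norm S)"
  proof (cases "S = 0")
    case True
    then show ?thesis using that[of 1] by simp
  next
    case False
    have "cnj S / of_real (norm S) * S = (S * cnj S) / of_real (norm S)" by simp
    also have "\<dots> = of_real (norm S)"
      using False by (simp add: complex_norm_square[symmetric] power2_eq_square)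
    finally show ?thesis using that[of "cnj S / of_real (norm S)"] False by (simp add: norm_divide)
  qed
  define d where "d y = \<omega> * c y" for y
  have Re_mult: "Re a * Re b + Im a * Im b = Re (b * cnj a)" for a b by (simp add: mult.commute)
  have "bil X Y w (\<lambda>x. Re (c x)) (\<lambda>y. Re (d y)) + bil X Y w (\<lambda>x. Im (c x)) (\<lambda>y. Im (d y))
      = (\<Sum>x\<in>X. \<Sum>y\<in>Y. w x y * (Re (c x) * Re (d y) + Im (c x) * Im (d y)))"
    unfolding bil_def sum.distrib[symmetric] by (simp add: algebra_simps)
  also have "\<dots> = Re (\<Sum>x\<in>X. \<Sum>y\<in>Y. of_real (w x y) * (d y * cnj (c x)))"
    unfolding Re_mult by simp
  also have "(\<Sum>x\<in>X. \<Sum>y\<in>Y. of_real (w x y) * (d y * cnj (c x))) = \<omega> * S"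
    by (simp add: S_def d_def sum_distrib_left mult_ac)
  finally have B: "bil X Y w (\<lambda>x. Re (c x)) (\<lambda>y. Re (d y)) + bil X Y w (\<lambda>x. Im (c x)) (\<lambda>y. Im (d y)) = norm S"
    by (simp add: om)
  have NX: "sqn X (\<lambda>x. Re (c x)) + sqn X (\<lambda>x. Im (c x)) = N X"
    by (simp only: sqn_def N_def sum.distrib cmod_power2)
  have "sqn Y (\<lambda>y. Re (d y)) + sqn Y (\<lambda>y. Im (d y)) = (\<Sum>y\<in>Y. (norm (d y))\<^sup>2)"
    by (simp only: sqn_def sum.distrib cmod_power2)
  also have "\<dots> = N Y" by (simp add: N_def d_def norm_mult om)
  finally have NY: "sqn Y (\<lambda>y. Re (d y)) + sqn Y (\<lambda>y. Im (d y)) = N Y" .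
  have "N X + N Y = N (verts \<Gamma>)"
    unfolding V(1) N_def using V by (simp add: sum.union_disjoint)
  also have "\<dots> > 0" unfolding N_def
    by (rule sum_pos2[of _ x0]) (use x0 V in auto)
  finally have pos: "N X + N Y > 0" .
  show ?thesis
  proof (rule that)
    show "2 * bil X Y w (\<lambda>x. Re (c x)) (\<lambda>y. Re (d y)) + 2 * bil X Y w (\<lambda>x. Im (c x)) (\<lambda>y. Im (d y))
      = sg_radius \<Gamma> * ((sqn X (\<lambda>x. Re (c x)) + sqn Y (\<lambda>y. Re (d y)))
        + (sqn X (\<lambda>x. Im (c x)) + sqn Y (\<lambda>y. Im (d y))))"
      (is "2 * ?a + 2 * ?b = ?r * ((?p + ?q) + (?s + ?t))")
    proof -
      have "(?p + ?q) + (?s + ?t) = N X + N Y" using NX NY by linarith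
      moreover have "2 * ?a + 2 * ?b = norm S + norm S" using B by linarith
      ultimately show ?thesis using SX SY by (simp only: distrib_left)
    qed
    show "(sqn X (\<lambda>x. Re (c x)) + sqn Y (\<lambda>y. Re (d y)))
        + (sqn X (\<lambda>x. Im (c x)) + sqn Y (\<lambda>y. Im (d y))) > 0"
      using pos NX NY by linarith
  qed
qed

text \<open>The bound is added up over the real and the imaginary pair of vectors. If the radius
  equals \<open>\<beta>\<close>, equality holds for each pair, and at least one pair is
  nonzero.\<close>

lemma sg_radius_le_bil:
  assumes G: "signed_graph \<Gamma>" "bipartition \<Gamma> X Y" and ne: "verts \<Gamma> \<noteq> {}"
  defines "w \<equiv> \<lambda>x y. real_of_int (adj \<Gamma> x y)"
  assumes le: "\<And>f g. 2 * bil X Y w f g \<le> \<beta> * (sqn X f + sqn Y g)"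
  shows "sg_radius \<Gamma> \<le> \<beta>"
    and "sg_radius \<Gamma> = \<beta> \<Longrightarrow> \<exists>f g. sqn X f + sqn Y g \<noteq> 0 \<and> 2 * bil X Y w f g = \<beta> * (sqn X f + sqn Y g)"
proof -
  obtain f g h k where
    eq: "2 * bil X Y w f g + 2 * bil X Y w h k = sg_radius \<Gamma> * ((sqn X f + sqn Y g) + (sqn X h + sqn Y k))"
    and pos: "(sqn X f + sqn Y g) + (sqn X h + sqn Y k) > 0"
    by (rule sg_radius_real_vectors[OF G ne, folded w_def]) (rule that)
  note l = le[of f g] le[of h k]
  define n m where "n = sqn X f + sqn Y g" and "m = sqn X h + sqn Y k"
  note eq = eq[folded n_def m_def] and pos = pos[folded n_def m_def] and l = l[folded n_def m_def]
  have "sg_radius \<Gamma> * (n + m) \<le> \<beta> * (n + m)"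
    unfolding distrib_left using l eq[unfolded distrib_left] by linarith
  then show "sg_radius \<Gamma> \<le> \<beta>" by (rule mult_right_le_imp_le[OF _ pos])
  assume "sg_radius \<Gamma> = \<beta>"
  then have "2 * bil X Y w f g = \<beta> * n" "2 * bil X Y w h k = \<beta> * m"
    using eq l by (simp_all only: distrib_left)
  moreover have "n \<noteq> 0 \<or> m \<noteq> 0" using pos by linarith
  ultimately show "\<exists>f g. sqn X f + sqn Y g \<noteq> 0 \<and> 2 * bil X Y w f g = \<beta> * (sqn X f + sqn Y g)" unfolding n_def m_def by blast
qed

section \<open>Cycles and switching\<close>

lemma cycle_edges_4:
  "cycle_edges [a, b, c, d] = {{a, b}, {b, c}, {c, d}, {d, a}}"
proof -
  have "{i. i < length [a, b, c, d]} = {0, Suc 0, Suc (Suc 0), Suc (Suc (Suc 0))}"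
    by (auto simp: less_Suc_eq)
  then show ?thesis unfolding cycle_edges_def setcompr_eq_image by simp
qed

lemma adj_neq_0_iff: "signed_graph \<Gamma> \<Longrightarrow> adj \<Gamma> x y \<noteq> 0 \<longleftrightarrow> {x, y} \<in> edges \<Gamma>"
  by (auto simp: adj_def signed_graph_def)

text \<open>If \<open>x = x'\<close> or \<open>y = y'\<close> the product is a square. Otherwise a
  negative product makes \<open>x\<close>, \<open>y\<close>, \<open>x'\<close>, \<open>y'\<close> a
  4-cycle with an odd number of negative edges.\<close>

lemma quad_nonneg:
  assumes G: "signed_graph \<Gamma>" "bipartition \<Gamma> X Y"
    and no4: "\<not> (\<exists>c. negative_cycle \<Gamma> c \<and> length c = 4)"
    and xy: "x \<in> X" "x' \<in> X" "y \<in> Y" "y' \<in> Y"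
  shows "0 \<le> adj \<Gamma> x y * adj \<Gamma> x y' * adj \<Gamma> x' y * adj \<Gamma> x' y'"
proof (rule ccontr)
  assume neg: "\<not> ?thesis"
  let ?c = "[x, y, x', y']"
  have "x \<noteq> x'"
  proof
    assume "x = x'"
    have "0 \<le> (adj \<Gamma> x' y * adj \<Gamma> x' y')\<^sup>2" by (rule zero_le_power2)
    then show False using neg unfolding \<open>x = x'\<close> by (simp only: power2_eq_square mult.assoc simp_thms)
  qed
  have "y \<noteq> y'"
  proof
    assume "y = y'"
    have "0 \<le> (adj \<Gamma> x y' * adj \<Gamma> x' y')\<^sup>2" by (rule zero_le_power2)
    then show False using neg unfolding \<open>y = y'\<close> by (simp only: power2_eq_square mult_ac simp_thms)
  qed
  note disj = bipartition_verts(2,1)[OF G]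
  have ne: "x \<noteq> y" "x \<noteq> y'" "x' \<noteq> y" "x' \<noteq> y'" using xy disj(1) by blast+
  have "adj \<Gamma> x y * adj \<Gamma> x y' * adj \<Gamma> x' y * adj \<Gamma> x' y' \<noteq> 0" using neg by linarith
  then have "adj \<Gamma> x y \<noteq> 0" "adj \<Gamma> x y' \<noteq> 0" "adj \<Gamma> x' y \<noteq> 0" "adj \<Gamma> x' y' \<noteq> 0"
    by simp_all
  then have E: "{x, y} \<in> edges \<Gamma>" "{x, y'} \<in> edges \<Gamma>" "{x', y} \<in> edges \<Gamma>" "{x', y'} \<in> edges \<Gamma>"
    by (simp_all add: adj_neq_0_iff[OF G(1)])
  let ?s = "sign \<Gamma>"
  have S: "?s {x, y} \<in> {-1, 1}" "?s {x, y'} \<in> {-1, 1}" "?s {x', y} \<in> {-1, 1}" "?s {x', y'} \<in> {-1, 1}"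
    using E G(1) unfolding signed_graph_def by blast+
  have neg_prod: "?s {x, y} * ?s {x, y'} * ?s {x', y} * ?s {x', y'} < 0"
    using neg unfolding adj_def by (simp only: E if_True not_le)
  define A where "A = cycle_edges ?c"
  have A: "A = {{x, y}, {y, x'}, {x', y'}, {y', x}}" by (simp add: A_def cycle_edges_4)
  have A': "A = {{x, y}, {x', y}, {x', y'}, {x, y'}}" unfolding A by (simp only: insert_commute[of y x' "{}"] insert_commute[of y' x "{}"])
  have dist: "distinct [{x, y}, {x', y}, {x', y'}, {x, y'}]"
    using \<open>x \<noteq> x'\<close> \<open>y \<noteq> y'\<close> ne by (simp add: doubleton_eq_iff)
  have "{e \<in> A. ?s e = -1} = set (filter (\<lambda>e. ?s e = -1) [{x, y}, {x', y}, {x', y'}, {x, y'}])"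
    unfolding A' set_filter by (simp only: list.set)
  then have "card {e \<in> A. ?s e = -1} = length (filter (\<lambda>e. ?s e = -1) [{x, y}, {x', y}, {x', y'}, {x, y'}])"
    using dist by (simp only: distinct_card distinct_filter)
  \<comment> \<open>A negative product of four signs leaves only the patterns with one or three
    entries -1.\<close>
  also have "odd \<dots>"
    using S neg_prod unfolding insert_iff empty_iff by (elim disjE) simp_all
  finally have "odd (card {e \<in> A. ?s e = -1})" .
  moreover have "is_cycle \<Gamma> ?c"
    unfolding is_cycle_def A_def[symmetric] A'
    using E xy disj(2) not_sym[OF ne(3)] \<open>x \<noteq> x'\<close> \<open>y \<noteq> y'\<close> ne by simp
  ultimately have "negative_cycle \<Gamma> ?c" by (simp add: negative_cycle_def A_def)
  then have "\<exists>c. negative_cycle \<Gamma> c \<and> length c = 4" by (intro exI[of _ ?c]) simp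
  then show False using no4 by contradiction
qed

text \<open>Two positions with the same edge would have to be successors of each other, which is
  impossible on a cycle of length at least 3. This allows products over the edge set to be indexed
  by positions.\<close>

lemma inj_on_cycle_edge:
  assumes "distinct c" "3 \<le> length c"
  shows "inj_on (\<lambda>i. {c ! i, c ! (Suc i mod length c)}) {..<length c}"
proof (rule inj_onI)
  let ?n = "length c"
  fix i j assume ij: "i \<in> {..<?n}" "j \<in> {..<?n}"
    and eq: "{c ! i, c ! (Suc i mod ?n)} = {c ! j, c ! (Suc j mod ?n)}"
  have lt: "Suc i mod ?n < ?n" "Suc j mod ?n < ?n" using assms by (auto intro!: mod_less_divisor)
  have nth: "c ! a = c ! b \<longleftrightarrow> a = b" if "a < ?n" "b < ?n" for a b
    using assms(1) that by (simp add: nth_eq_iff_index_eq)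
  have "i < ?n" "j < ?n" using ij by auto
  then have "i = j \<or> i = Suc j mod ?n \<and> Suc i mod ?n = j"
    using eq unfolding doubleton_eq_iff by (simp only: nth lt) blast
  moreover have False if "i = Suc j mod ?n" "Suc i mod ?n = j"
    using that ij assms(2) by (auto simp: mod_Suc split: if_splits)
  ultimately show "i = j" by blast
qed

text \<open>If all edge signs are products of vertex signs, the sign of a cycle is a product of squares.\<close>

lemma not_unbalancedI:
  fixes \<tau> :: "'a \<Rightarrow> int"
  assumes "\<And>x. \<tau> x * \<tau> x = 1" and s: "\<And>x y. {x, y} \<in> edges \<Gamma> \<Longrightarrow> sign \<Gamma> {x, y} = \<tau> x * \<tau> y"
    and G: "signed_graph \<Gamma>"
  shows "\<not> unbalanced \<Gamma>"
proof
  assume "unbalanced \<Gamma>"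
  then obtain c where c: "is_cycle \<Gamma> c" "odd (card {e \<in> cycle_edges c. sign \<Gamma> e = -1})"
    by (auto simp: unbalanced_def negative_cycle_def)
  let ?n = "length c"
  define h where "h i = {c ! i, c ! (Suc i mod ?n)}" for i
  have n: "3 \<le> ?n" "distinct c" "cycle_edges c \<subseteq> edges \<Gamma>" using c by (auto simp: is_cycle_def)
  have ce: "cycle_edges c = h ` {..<?n}" by (auto simp: cycle_edges_def h_def)
  then have fin: "finite (cycle_edges c)" by simp
  have inj: "inj_on h {..<?n}" unfolding h_def by (rule inj_on_cycle_edge[OF n(2,1)])
  have hE: "h i \<in> edges \<Gamma>" if "i < ?n" for i using n(3) that unfolding ce by blast
  \<comment> \<open>The cyclic shift permutes the positions, so start points and end points of the
    edges contribute the same product.\<close>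
  have rot: "bij_betw (\<lambda>i. Suc i mod ?n) {..<?n} {..<?n}"
  proof (rule bij_betwI')
    fix y assume y: "y \<in> {..<?n}"
    show "\<exists>x\<in>{..<?n}. y = Suc x mod ?n"
    proof (cases "y = 0")
      case True
      have "Suc (?n - 1) = ?n" using n(1) by linarith
      then have "Suc (?n - 1) mod ?n = 0" by (simp only: mod_self)
      then show ?thesis using True n(1) by (intro bexI[of _ "?n - 1"]) simp_all
    next
      case False
      then show ?thesis using y by (intro bexI[of _ "y - 1"]) auto
    qed
  qed (use n in \<open>auto simp: mod_Suc split: if_splits\<close>)
  have "(\<Prod>e\<in>cycle_edges c. sign \<Gamma> e) = (\<Prod>i<?n. sign \<Gamma> (h i))"
    unfolding ce by (rule prod.reindex_cong[OF inj]) auto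
  also have "\<dots> = (\<Prod>i<?n. \<tau> (c ! i) * \<tau> (c ! (Suc i mod ?n)))"
    using hE unfolding h_def by (intro prod.cong refl s) simp
  also have "\<dots> = (\<Prod>i<?n. \<tau> (c ! i)) * (\<Prod>i<?n. \<tau> (c ! (Suc i mod ?n)))"
    by (simp add: prod.distrib)
  also have "(\<Prod>i<?n. \<tau> (c ! (Suc i mod ?n))) = (\<Prod>i<?n. \<tau> (c ! i))"
    by (rule prod.reindex_bij_betw[OF rot])
  also have "(\<Prod>i<?n. \<tau> (c ! i)) * (\<Prod>i<?n. \<tau> (c ! i)) = 1"
    by (simp add: prod.distrib[symmetric] assms(1))
  finally have 1: "(\<Prod>e\<in>cycle_edges c. sign \<Gamma> e) = 1" .
  have "sign \<Gamma> e = (if sign \<Gamma> e = -1 then -1 else 1)" if "e \<in> cycle_edges c" for e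
    using that n(3) G by (auto simp: signed_graph_def)
  then have "(\<Prod>e\<in>cycle_edges c. sign \<Gamma> e) = (\<Prod>e\<in>cycle_edges c. if sign \<Gamma> e = -1 then -1 else 1)"
    by (rule prod.cong[OF refl])
  also have "\<dots> = (-1) ^ card {e \<in> cycle_edges c. sign \<Gamma> e = -1}"
    using fin by (simp add: prod.If_cases Int_def)
  finally show False using 1 c(2) by simp
qed

text \<open>For \<open>unbal\<close>: signings that make every entry nonnegative would write each
  edge sign as a product of vertex signs, contradicting imbalance by
  \<open>not_unbalancedI\<close>.\<close>

lemma unbalanced_array_adj:
  assumes G: "signed_graph \<Gamma>" "bipartition \<Gamma> X Y" and unb: "unbalanced \<Gamma>"
    and no4: "\<not> (\<exists>c. negative_cycle \<Gamma> c \<and> length c = 4)"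
  shows "unbalanced_array X Y (\<lambda>x y. real_of_int (adj \<Gamma> x y))"
proof
  note V = bipartition_verts[OF G]
  show "finite X" "finite Y" using V by auto
  show "real_of_int (adj \<Gamma> x y) \<in> {-1, 0, 1}" for x y
    using G(1) by (auto simp: adj_def signed_graph_def)
  show "0 \<le> real_of_int (adj \<Gamma> x y) * real_of_int (adj \<Gamma> x y') * real_of_int (adj \<Gamma> x' y) * real_of_int (adj \<Gamma> x' y')"
    if "x \<in> X" "x' \<in> X" "y \<in> Y" "y' \<in> Y" for x x' y y'
    using quad_nonneg[OF G no4 that] by (simp flip: of_int_mult)
  fix \<theta> \<eta> :: "'a \<Rightarrow> real" assume s: "is_signing \<theta>" "is_signing \<eta>"
  show "\<exists>x\<in>X. \<exists>y\<in>Y. resign \<theta> \<eta> (\<lambda>x y. real_of_int (adj \<Gamma> x y)) x y < 0"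
  proof (rule ccontr)
    assume "\<not> ?thesis"
    then have nn: "0 \<le> \<theta> x * adj \<Gamma> x y * \<eta> y" if "x \<in> X" "y \<in> Y" for x y
      using that by (fastforce simp: resign_def)
    define \<tau> :: "'a \<Rightarrow> int" where
      "\<tau> z = (if (if z \<in> X then \<theta> z else \<eta> z) = 1 then 1 else -1)" for z
    have e: "sign \<Gamma> {x, y} = \<tau> x * \<tau> y" if "x \<in> X" "y \<in> Y" "{x, y} \<in> edges \<Gamma>" for x y
    proof -
      have "y \<notin> X" using that V by auto
      have "sign \<Gamma> {x, y} = -1 \<or> sign \<Gamma> {x, y} = 1" using that(3) G(1) by (auto simp: signed_graph_def)
      moreover have "\<theta> x = 1 \<or> \<theta> x = -1" "\<eta> y = 1 \<or> \<eta> y = -1" using s by (auto simp: is_signing_def)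
      ultimately show ?thesis
        using nn[OF that(1,2)] that \<open>y \<notin> X\<close> by (auto simp: \<tau>_def adj_def)
    qed
    have "sign \<Gamma> {x, y} = \<tau> x * \<tau> y" if "{x, y} \<in> edges \<Gamma>" for x y
    proof -
      have "{y, x} = {x, y}" by (rule insert_commute)
      then show ?thesis
        using bipartition_edge[OF G(2) that] e[of x y] e[of y x] that by (elim disjE) simp_all
    qed
    then have "\<not> unbalanced \<Gamma>"
      by (intro not_unbalancedI[OF _ _ G(1), of \<tau>]) (simp_all add: \<tau>_def)
    then show False using unb by contradiction
  qed
qed

section \<open>Switching isomorphism in terms of adjacency entries\<close>

lemma card_doubleton_Int:
  assumes "a \<noteq> b"
  shows "card ({a, b} \<inter> U) = 1 \<longleftrightarrow> (a \<in> U) \<noteq> (b \<in> U)"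
  using assms by (cases "a \<in> U"; cases "b \<in> U") (auto simp: Int_insert_left)

lemma signed_graph_edge:
  assumes "signed_graph \<Gamma>" "{x, y} \<in> edges \<Gamma>"
  shows "x \<in> verts \<Gamma>" "y \<in> verts \<Gamma>" "x \<noteq> y"
proof -
  have "{x, y} \<subseteq> verts \<Gamma> \<and> card {x, y} = 2"
    using assms unfolding signed_graph_def by (elim conjE) (erule bspec)
  then show "x \<in> verts \<Gamma>" "y \<in> verts \<Gamma>" "x \<noteq> y" by (auto simp: card_insert_if)
qed

lemma edge_doubleton:
  assumes "signed_graph \<Gamma>" "e \<in> edges \<Gamma>"
  obtains x y where "e = {x, y}"
proof -
  have "card e = 2" using assms by (simp add: signed_graph_def)
  then show ?thesis using that by (auto simp: card_2_iff)
qed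

text \<open>Switching isomorphism is conjugacy of adjacency matrices by a signed permutation; this
  direction is used to transport eigenvectors.\<close>

lemma switching_isomorphicD:
  assumes G: "signed_graph \<Gamma>" "signed_graph \<Delta>" and iso: "switching_isomorphic \<Gamma> \<Delta>"
  obtains f and \<tau> :: "'a \<Rightarrow> int" where "bij_betw f (verts \<Gamma>) (verts \<Delta>)" "\<And>x. \<tau> x * \<tau> x = 1"
    "\<And>x y. x \<in> verts \<Gamma> \<Longrightarrow> y \<in> verts \<Gamma> \<Longrightarrow> adj \<Gamma> x y = \<tau> x * \<tau> y * adj \<Delta> (f x) (f y)"
proof -
  obtain \<Delta>' where eqv: "switching_equivalent \<Delta>' \<Delta>" and isom: "isomorphic \<Gamma> \<Delta>'"
    using iso by (auto simp only: switching_isomorphic_def)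
  obtain U where eq: "same_sgraph \<Delta>' (switch U \<Delta>)"
    using eqv by (auto simp only: switching_equivalent_def)
  obtain f where f: "bij_betw f (verts \<Gamma>) (verts \<Delta>')" "edges \<Delta>' = (\<lambda>e. f ` e) ` edges \<Gamma>"
      "\<forall>e\<in>edges \<Gamma>. sign \<Delta>' (f ` e) = sign \<Gamma> e"
    using isom by (auto simp only: isomorphic_def)
  have D: "verts \<Delta>' = verts \<Delta>" "edges \<Delta>' = edges \<Delta>"
    and sD: "\<And>e. e \<in> edges \<Delta> \<Longrightarrow> sign \<Delta>' e = (if card (e \<inter> U) = 1 then - sign \<Delta> e else sign \<Delta> e)"
    using eq by (auto simp: same_sgraph_def switch_def)
  \<comment> \<open>The sign is -1 on the preimage of the switching set.\<close>
  define \<tau> :: "'a \<Rightarrow> int" where "\<tau> x = (if f x \<in> U then -1 else 1)" for x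
  have inj: "inj_on f (verts \<Gamma>)" using f(1) by (simp add: bij_betw_def)
  show ?thesis
  proof (rule that)
    show "bij_betw f (verts \<Gamma>) (verts \<Delta>)" using f(1) D by simp
    show "\<tau> x * \<tau> x = 1" for x by (simp add: \<tau>_def)
    fix x y assume xy: "x \<in> verts \<Gamma>" "y \<in> verts \<Gamma>"
    have img: "{f x, f y} = f ` {x, y}" by simp
    have iff: "{f x, f y} \<in> edges \<Delta> \<longleftrightarrow> {x, y} \<in> edges \<Gamma>"
    proof
      assume "{f x, f y} \<in> edges \<Delta>"
      then obtain e where e: "e \<in> edges \<Gamma>" "f ` {x, y} = f ` e" using f(2) D unfolding img by auto
      have "e \<subseteq> verts \<Gamma>" using e(1) G(1) by (auto simp: signed_graph_def)
      then have "{x, y} = e"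
        using inj_on_image_eq_iff[OF inj, of "{x, y}" e] e(2) xy by simp
      then show "{x, y} \<in> edges \<Gamma>" using e(1) by simp
    next
      assume "{x, y} \<in> edges \<Gamma>"
      then have "f ` {x, y} \<in> edges \<Delta>'" unfolding f(2) by (rule imageI)
      then show "{f x, f y} \<in> edges \<Delta>" using D by simp
    qed
    show "adj \<Gamma> x y = \<tau> x * \<tau> y * adj \<Delta> (f x) (f y)"
    proof (cases "{x, y} \<in> edges \<Gamma>")
      case False
      then show ?thesis using iff by (simp add: adj_def)
    next
      case True
      then have E: "{f x, f y} \<in> edges \<Delta>" using iff by simp
      have "sign \<Gamma> {x, y} = sign \<Delta>' {f x, f y}" using f(3) True by (metis img)
      also have "\<dots> = \<tau> x * \<tau> y * sign \<Delta> {f x, f y}"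
        unfolding sD[OF E] card_doubleton_Int[OF signed_graph_edge(3)[OF G(2) E]] by (simp add: \<tau>_def)
      finally show ?thesis using True E by (simp add: adj_def)
    qed
  qed
qed

text \<open>The intermediate graph is \<open>switch U \<Delta>\<close> with \<open>U\<close> the
  image of the vertices of sign -1. Edges are the nonzero adjacency entries, so the matrix identity
  also determines the edge set.\<close>

lemma switching_isomorphicI:
  fixes \<tau> :: "'a \<Rightarrow> int"
  assumes G: "signed_graph \<Gamma>" "signed_graph \<Delta>" and bij: "bij_betw f (verts \<Gamma>) (verts \<Delta>)"
    and \<tau>: "\<And>x. \<tau> x \<in> {-1, 1}"
    and adj: "\<And>x y. x \<in> verts \<Gamma> \<Longrightarrow> y \<in> verts \<Gamma> \<Longrightarrow> adj \<Gamma> x y = \<tau> x * \<tau> y * adj \<Delta> (f x) (f y)"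
  shows "switching_isomorphic \<Gamma> \<Delta>"
proof -
  define U where "U = f ` {x \<in> verts \<Gamma>. \<tau> x = -1}"
  have surj: "verts \<Delta> = f ` verts \<Gamma>" and inj: "inj_on f (verts \<Gamma>)"
    using bij by (auto simp: bij_betw_def)
  have U: "U \<subseteq> verts \<Delta>" unfolding U_def surj by auto
  have fU: "f x \<in> U \<longleftrightarrow> \<tau> x = -1" if "x \<in> verts \<Gamma>" for x
    using that inj by (auto simp: U_def dest: inj_onD)
  have \<tau>0: "\<tau> x \<noteq> 0" for x using \<tau>[of x] by auto
  have "edges \<Delta> = (\<lambda>e. f ` e) ` edges \<Gamma>"
  proof (intro equalityI subsetI)
    fix e assume e: "e \<in> edges \<Delta>"
    obtain a b where ab: "e = {a, b}" by (rule edge_doubleton[OF G(2) e])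
    then have "a \<in> verts \<Delta>" "b \<in> verts \<Delta>" using signed_graph_edge[OF G(2)] e by auto
    then obtain x y where xy: "x \<in> verts \<Gamma>" "y \<in> verts \<Gamma>" "a = f x" "b = f y" unfolding surj by auto
    have "adj \<Gamma> x y \<noteq> 0" using adj[OF xy(1,2)] adj_neq_0_iff[OF G(2)] e \<tau>0 unfolding ab xy(3,4) by simp
    then have "{x, y} \<in> edges \<Gamma>" using adj_neq_0_iff[OF G(1)] by simp
    then show "e \<in> (\<lambda>e. f ` e) ` edges \<Gamma>" unfolding ab xy(3,4) by (intro image_eqI[of _ _ "{x, y}"]) auto
  next
    fix e assume "e \<in> (\<lambda>e. f ` e) ` edges \<Gamma>"
    then obtain e' where e': "e' \<in> edges \<Gamma>" "e = f ` e'" by blast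
    obtain x y where xy: "e' = {x, y}" by (rule edge_doubleton[OF G(1) e'(1)])
    then have v: "x \<in> verts \<Gamma>" "y \<in> verts \<Gamma>" using signed_graph_edge[OF G(1)] e' by auto
    have "adj \<Gamma> x y \<noteq> 0" using adj_neq_0_iff[OF G(1)] e' xy by simp
    then have "adj \<Delta> (f x) (f y) \<noteq> 0" using adj[OF v] by simp
    then show "e \<in> edges \<Delta>" using adj_neq_0_iff[OF G(2)] e' xy by simp
  qed
  moreover have "sign (switch U \<Delta>) (f ` e) = sign \<Gamma> e" if e: "e \<in> edges \<Gamma>" for e
  proof -
    obtain x y where xy: "e = {x, y}" by (rule edge_doubleton[OF G(1) e])
    note v = signed_graph_edge[OF G(1) e[unfolded xy]]
    have E: "{f x, f y} \<in> edges \<Delta>" using imageI[OF e, of "(`) f"] calculation unfolding xy by simp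
    have "\<tau> x * \<tau> y = (if (\<tau> x = -1) \<noteq> (\<tau> y = -1) then -1 else 1)" using \<tau>[of x] \<tau>[of y] by auto
    moreover have "sign \<Gamma> {x, y} = \<tau> x * \<tau> y * sign \<Delta> {f x, f y}"
      using adj[OF v(1,2)] e E unfolding xy by (simp add: adj_def)
    ultimately show ?thesis
      unfolding xy using card_doubleton_Int[OF signed_graph_edge(3)[OF G(2) E], of U] fU v
      by (simp add: switch_def)
  qed
  ultimately have "isomorphic \<Gamma> (switch U \<Delta>)"
    using bij unfolding isomorphic_def by (intro exI[of _ f]) (simp add: switch_def)
  moreover have "switching_equivalent (switch U \<Delta>) \<Delta>"
    using U unfolding switching_equivalent_def by (intro exI[of _ U]) (simp add: same_sgraph_def)
  ultimately show ?thesis unfolding switching_isomorphic_def by blast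
qed

section \<open>The extremal graph\<close>

lemma Gamma_rs_edge:
  "{Inl i, Inr j} \<in> edges (Gamma_rs r s) \<longleftrightarrow>
    (i < r - 1 \<and> j < s - 1 \<and> \<not> (i = 0 \<and> j = 0)) \<or> (i = 0 \<and> j = s - 1)
      \<or> (i = r - 1 \<and> j = s - 1) \<or> (i = r - 1 \<and> j = 0)"
  by (auto simp: Gamma_rs_def Let_def doubleton_eq_iff)

lemma Gamma_rs_edgeE:
  assumes "2 \<le> r" "2 \<le> s" "e \<in> edges (Gamma_rs r s)"
  obtains i j where "i < r" "j < s" "e = {Inl i, Inr j}"
proof -
  consider i j where "i < r - 1" "j < s - 1" "e = {Inl i, Inr j}" | "e = {Inl 0, Inr (s - 1)}"
    | "e = {Inl (r - 1), Inr (s - 1)}" | "e = {Inl (r - 1), Inr 0}"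
    using assms(3) by (auto simp: Gamma_rs_def Let_def insert_commute)
  then show ?thesis
  proof cases
    case 1
    then show ?thesis using that[of i j] by simp
  next
    case 2
    then show ?thesis using that[of 0 "s - 1"] assms by simp
  next
    case 3
    then show ?thesis using that[of "r - 1" "s - 1"] assms by simp
  next
    case 4
    then show ?thesis using that[of "r - 1" 0] assms by simp
  qed
qed

lemma Gamma_rs_verts: "verts (Gamma_rs r s) = Inl ` {..<r} \<union> Inr ` {..<s}"
  by (simp add: Gamma_rs_def Let_def)

lemma signed_graph_Gamma_rs:
  assumes "2 \<le> r" "2 \<le> s"
  shows "signed_graph (Gamma_rs r s)"
  unfolding signed_graph_def
proof (intro conjI ballI)
  show "finite (verts (Gamma_rs r s))" by (simp add: Gamma_rs_verts)
  fix e assume e: "e \<in> edges (Gamma_rs r s)"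
  obtain i j where "i < r" "j < s" "e = {Inl i, Inr j}" by (rule Gamma_rs_edgeE[OF assms e])
  then show "e \<subseteq> verts (Gamma_rs r s)" "card e = 2" by (simp_all add: Gamma_rs_verts)
  show "sign (Gamma_rs r s) e \<in> {-1, 1}" by (simp add: Gamma_rs_def Let_def)
qed

lemma bipartition_Gamma_rs:
  assumes "2 \<le> r" "2 \<le> s"
  shows "bipartition (Gamma_rs r s) (Inl ` {..<r}) (Inr ` {..<s})"
  unfolding bipartition_def
proof (intro conjI ballI)
  fix e assume e: "e \<in> edges (Gamma_rs r s)"
  obtain i j where "i < r" "j < s" "e = {Inl i, Inr j}" by (rule Gamma_rs_edgeE[OF assms e])
  then show "\<exists>x\<in>Inl ` {..<r}. \<exists>y\<in>Inr ` {..<s}. e = {x, y}" by blast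
qed (auto simp: Gamma_rs_verts)

text \<open>The extremal graph is itself a hexagon blow-up: the hexagon's negative edge is
  \<open>u\<^sub>1 v\<^sub>1\<close>, and \<open>P\<close> and \<open>Q\<close> are the singletons
  of the graph's vertices \<open>u\<close> and \<open>v\<close>, whose edge was deleted.\<close>

lemma adj_Gamma_rs:
  assumes "2 \<le> r" "2 \<le> s" "i < r" "j < s"
  shows "of_int (adj (Gamma_rs r s) (Inl i) (Inr j)) = hexsign {0} {0} (r - 1) (s - 1) i j"
proof -
  have "sign (Gamma_rs r s) {Inl i, Inr j} = (if i = r - 1 \<and> j = s - 1 then -1 else 1)"
    by (simp add: Gamma_rs_def Let_def doubleton_eq_iff)
  then show ?thesis
    unfolding adj_def Gamma_rs_edge hexsign_def using assms by auto
qed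

text \<open>The values \<open>a\<close>, \<open>b\<close> and \<open>a + b\<close> on \<open>v\<close>, \<open>v\<^sub>1\<close> and the remaining vertices of the second
  part turn the eigenvalue equations into two proportional linear equations for \<open>a\<close> and \<open>b\<close>;
  for \<open>s = 3\<close> (a negative hexagon) the eigenvalue is double and the generic solution \<open>(t - 2 - n, n - 1)\<close> vanishes.\<close>

lemma Gamma_rs_eigenvector:
  assumes rs: "3 \<le> r" "r \<le> s"
  defines "L \<equiv> sqrt (beta_sq (real r - 1) (real s - 1))"
  obtains f g :: "nat \<Rightarrow> real" and j where "j < s" "g j \<noteq> 0"
    "\<And>i. i < r \<Longrightarrow> (\<Sum>j<s. hexsign {0} {0} (r - 1) (s - 1) i j * g j) = L * f i"
    "\<And>j. j < s \<Longrightarrow> (\<Sum>i<r. hexsign {0} {0} (r - 1) (s - 1) i j * f i) = L * g j"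
proof -
  have hex: "hex_blowup {..<r} {0} {..<s} {0} (r - 1) (s - 1)"
  proof
    have "1 \<in> {..<r} - {r - 1} - {0}" "1 \<in> {..<s} - {s - 1} - {0}" using rs by auto
    then show "{..<r} - {r - 1} - {0} \<noteq> {}" "{..<s} - {s - 1} - {0} \<noteq> {}" by blast+
  qed (use rs in auto)
  interpret hex_blowup "{..<r}" "{0}" "{..<s}" "{0}" "r - 1" "s - 1" by (rule hex)
  define t where "t = beta_sq (real r - 1) (real s - 1)"
  have k: "real r - 1 \<ge> 2" "real s - 1 \<ge> 2" using rs by linarith+
  \<comment> \<open>The two identities for \<open>t\<close> make the system below singular and
    \<open>L\<close> positive.\<close>
  note t = beta_sq[OF k, folded t_def]
  have l: "L > 0" "L * L = t" using t(3) by (simp_all add: L_def t_def)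
  define m n where "m = real r - 2" and "n = real s - 2"
  have card: "real (card ({..<r} - {r - 1} - {0})) = m" "real (card ({..<s} - {s - 1} - {0})) = n"
    using card_split by (simp_all add: m_def n_def)
  \<comment> \<open>These are the column equations at \<open>v\<^sub>1\<close> and \<open>v\<close>,
    with \<open>m\<close> and \<open>n\<close> the sizes of the two large classes; the determinant
    of the system is minus the quadratic that \<open>t\<close> solves, up to sign.\<close>
  have "\<exists>a b. (a \<noteq> 0 \<or> b \<noteq> 0) \<and> b * (t - 2 - n) = (n - 1) * a \<and> (1 + m - t) * a - b + m * n * (a + b) = 0"
  proof (cases "s = 3")
    case True
    then have "m = 1" "n = 1" "t = 3"
      using rs by (simp_all add: m_def n_def t_def beta_sq_def power2_eq_square)
    then show ?thesis by (intro exI[of _ 1] exI[of _ 0]) simp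
  next
    case False
    have "(1 + m - t) * (t - 2 - n) - (n - 1) + m * n * ((t - 2 - n) + (n - 1)) =
       - (t\<^sup>2 - ((real r - 1) * (real s - 1) + 2) * t + (2 * (real r - 1) - 1) * (2 * (real s - 1) - 1))"
      unfolding m_def n_def by (simp add: power2_eq_square algebra_simps)
    also have "\<dots> = 0" using t(1) by simp
    finally have "(1 + m - t) * (t - 2 - n) - (n - 1) + m * n * ((t - 2 - n) + (n - 1)) = 0" .
    moreover have "n - 1 \<noteq> 0" using False rs by (simp add: n_def)
    ultimately show ?thesis by (intro exI[of _ "t - 2 - n"] exI[of _ "n - 1"]) simp
  qed
  then obtain a b where ab: "a \<noteq> 0 \<or> b \<noteq> 0" and e1: "b * (t - 2 - n) = (n - 1) * a"
    and e2: "(1 + m - t) * a - b + m * n * (a + b) = 0" by blast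
  define g where "g j = (if j = s - 1 then b else if j = 0 then a else a + b)" for j
  \<comment> \<open>Forced by the row equations: \<open>f\<close> is the vector of row sums of
    \<open>g\<close> divided by \<open>L\<close>.\<close>
  define f where "f i = (if i = r - 1 then a - b else if i = 0 then n * (a + b) + b else a + n * (a + b)) / L" for i
  have g: "g (s - 1) = b" "sum g {0} = a" "sum g ({..<s} - {s - 1} - {0}) = n * (a + b)"
  proof -
    show "g (s - 1) = b" "sum g {0} = a" using rs by (simp_all add: g_def)
    have "sum g ({..<s} - {s - 1} - {0}) = sum (\<lambda>_. a + b) ({..<s} - {s - 1} - {0})"
      by (rule sum.cong) (auto simp: g_def)
    also have "\<dots> = n * (a + b)" by (simp only: sum_constant card)
    finally show "sum g ({..<s} - {s - 1} - {0}) = n * (a + b)" .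
  qed
  have f: "f (r - 1) = (a - b) / L" "sum f {0} = (n * (a + b) + b) / L"
    "sum f ({..<r} - {r - 1} - {0}) = m * ((a + n * (a + b)) / L)"
  proof -
    show "f (r - 1) = (a - b) / L" "sum f {0} = (n * (a + b) + b) / L" using rs by (simp_all add: f_def)
    have "sum f ({..<r} - {r - 1} - {0}) = sum (\<lambda>_. (a + n * (a + b)) / L) ({..<r} - {r - 1} - {0})"
      by (rule sum.cong) (auto simp: f_def)
    also have "\<dots> = m * ((a + n * (a + b)) / L)" by (simp only: sum_constant card)
    finally show "sum f ({..<r} - {r - 1} - {0}) = m * ((a + n * (a + b)) / L)" .
  qed
  have row: "(\<Sum>j<s. hexsign {0} {0} (r - 1) (s - 1) i j * g j) = L * f i" if "i < r" for i
    unfolding row_sum g f_def using l by simp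
  have col: "(\<Sum>i<r. hexsign {0} {0} (r - 1) (s - 1) i j * f i) = L * g j" if "j < s" for j
  proof -
    have sw: "hexsign {0} {0} (r - 1) (s - 1) i j = hexsign {0} {0} (s - 1) (r - 1) j i" for i
      by (rule hexsign_swap) (use rs in auto)
    have "(\<Sum>i<r. hexsign {0} {0} (r - 1) (s - 1) i j * f i)
        = (\<Sum>i<r. hexsign {0} {0} (s - 1) (r - 1) j i * f i)"
      by (simp only: sw)
    also have "\<dots> = (if j = s - 1 then sum f {0} - f (r - 1)
        else if j \<in> {0} then sum f ({..<r} - {r - 1} - {0}) + f (r - 1)
        else sum f {0} + sum f ({..<r} - {r - 1} - {0}))"
      by (rule hex_blowup.row_sum[OF hex_blowup_swap[OF hex]])
    also have "\<dots> = (if j = s - 1 then n * (a + b) + 2 * b - a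
        else if j = 0 then m * (a + n * (a + b)) + a - b
        else n * (a + b) + b + m * (a + n * (a + b))) / L"
      unfolding f using l(1) by (simp add: field_simps)
    also have "\<dots> = t * g j / L"
    proof -
      have 1: "n * (a + b) + 2 * b - a = t * b" using e1 by (simp add: algebra_simps)
      have 2: "m * (a + n * (a + b)) + a - b = t * a" using e2 by (simp add: algebra_simps)
      \<comment> \<open>The equation at the remaining vertices is the sum of the other two, which is
        why \<open>g\<close> is \<open>a + b\<close> there.\<close>
      have 3: "n * (a + b) + b + m * (a + n * (a + b)) = t * (a + b)"
        unfolding distrib_left[of t] 1[symmetric] 2[symmetric] by (simp add: algebra_simps)
      show ?thesis unfolding 1 2 3 by (simp add: g_def)
    qed
    also have "\<dots> = L * g j" unfolding l(2)[symmetric] using l(1) by simp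
    finally show ?thesis .
  qed
  show ?thesis
  proof (cases "a = 0")
    case True
    then show ?thesis using that[of "s - 1" g f] row col ab rs by (simp add: g_def)
  next
    case False
    then show ?thesis using that[of 0 g f] row col rs by (simp add: g_def)
  qed
qed

section \<open>Recognising the extremal graph and bounding its radius from below\<close>

lemma bij_betw_two_points:
  assumes "finite A" "card A = n" "a \<in> A" "b \<in> A" "a \<noteq> b"
  obtains g where "bij_betw g A {..<n}" "g a = n - 1" "g b = 0"
proof -
  have "card {a, b} \<le> n" using assms card_mono[of A "{a, b}"] by simp
  then have n: "2 \<le> n" using assms(5) by simp
  have "card (A - {a, b}) = card {1..<n - 1}"
    using assms n by (simp add: card_Diff_subset)
  then obtain g0 where g0: "bij_betw g0 (A - {a, b}) {1..<n - 1}"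
    using assms(1) finite_same_card_bij[of "A - {a, b}" "{1..<n - 1}"] by auto
  define g where "g x = (if x = a then n - 1 else if x = b then 0 else g0 x)" for x
  have "bij_betw g (A - {a, b}) {1..<n - 1}"
    by (rule iffD1[OF bij_betw_cong g0]) (simp add: g_def)
  moreover have "bij_betw g {a, b} {n - 1, 0}"
    using n assms(5) by (auto simp: bij_betw_def g_def)
  ultimately have "bij_betw g ((A - {a, b}) \<union> {a, b}) ({1..<n - 1} \<union> {n - 1, 0})"
    by (rule bij_betw_combine) auto
  moreover have "(A - {a, b}) \<union> {a, b} = A" using assms by auto
  moreover have "{1..<n - 1} \<union> {n - 1, 0} = {..<n}" using n by auto
  ultimately show ?thesis using that[of g] assms(5) by (simp add: g_def)
qed

text \<open>\<open>hexsign\<close> with singleton classes only tests equality with four vertices, so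
  any relabelling taking \<open>x1\<close>, \<open>x2\<close>, \<open>y1\<close>, \<open>y2\<close>
  to \<open>u\<^sub>1\<close>, \<open>u\<close>, \<open>v\<^sub>1\<close>, \<open>v\<close>
  identifies the switched graph with the extremal one.\<close>

lemma switching_isomorphic_Gamma_rsI:
  assumes G: "signed_graph \<Gamma>" "bipartition \<Gamma> X Y" and card: "card X = r" "card Y = s"
    and s: "is_signing \<theta>" "is_signing \<eta>"
    and xy: "x1 \<in> X" "x2 \<in> X" "x1 \<noteq> x2" "y1 \<in> Y" "y2 \<in> Y" "y1 \<noteq> y2"
    and w: "\<And>x y. x \<in> X \<Longrightarrow> y \<in> Y \<Longrightarrow>
      resign \<theta> \<eta> (\<lambda>x y. real_of_int (adj \<Gamma> x y)) x y = hexsign {x2} {y2} x1 y1 x y"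
  shows "switching_isomorphic \<Gamma> (Gamma_rs r s)"
proof -
  note V = bipartition_verts[OF G]
  have "card {x1, x2} \<le> r" "card {y1, y2} \<le> s"
    using card_mono[OF V(3), of "{x1, x2}"] card_mono[OF V(4), of "{y1, y2}"] card xy by simp_all
  then have rs: "2 \<le> r" "2 \<le> s" using xy by simp_all
  note G' = signed_graph_Gamma_rs[OF rs] bipartition_Gamma_rs[OF rs]
  obtain g where g: "bij_betw g X {..<r}" "g x1 = r - 1" "g x2 = 0"
    by (rule bij_betw_two_points[OF V(3) card(1) xy(1-3)])
  obtain h where h: "bij_betw h Y {..<s}" "h y1 = s - 1" "h y2 = 0"
    by (rule bij_betw_two_points[OF V(4) card(2) xy(4-6)])
  have gi: "g x = r - 1 \<longleftrightarrow> x = x1" "g x = 0 \<longleftrightarrow> x = x2" if "x \<in> X" for x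
    using inj_on_eq_iff[OF bij_betw_imp_inj_on[OF g(1)] that xy(1)]
      inj_on_eq_iff[OF bij_betw_imp_inj_on[OF g(1)] that xy(2)] g(2,3) by simp_all
  have hi: "h y = s - 1 \<longleftrightarrow> y = y1" "h y = 0 \<longleftrightarrow> y = y2" if "y \<in> Y" for y
    using inj_on_eq_iff[OF bij_betw_imp_inj_on[OF h(1)] that xy(4)]
      inj_on_eq_iff[OF bij_betw_imp_inj_on[OF h(1)] that xy(5)] h(2,3) by simp_all
  define F :: "'a \<Rightarrow> nat + nat" where "F z = (if z \<in> X then Inl (g z) else Inr (h z))" for z
  define \<tau> :: "'a \<Rightarrow> int" where "\<tau> z = (if (if z \<in> X then \<theta> z else \<eta> z) = 1 then 1 else -1)" for z
  have YX: "y \<notin> X" if "y \<in> Y" for y using that V(2) by auto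
  have FX: "F x = Inl (g x)" if "x \<in> X" for x using that by (simp add: F_def)
  have FY: "F y = Inr (h y)" if "y \<in> Y" for y using YX[OF that] by (simp add: F_def)
  have glt: "g x < r" if "x \<in> X" for x using bij_betw_apply[OF g(1) that] by simp
  have hlt: "h y < s" if "y \<in> Y" for y using bij_betw_apply[OF h(1) that] by simp
  have "bij_betw F X (Inl ` {..<r})"
  proof -
    have "bij_betw (Inl \<circ> g) X (Inl ` {..<r})"
      by (rule bij_betw_trans[OF g(1)]) (simp add: bij_betw_def)
    moreover have "bij_betw F X Z = bij_betw (Inl \<circ> g) X Z" for Z
      by (rule bij_betw_cong) (simp add: FX)
    ultimately show ?thesis by simp
  qed
  moreover have "bij_betw F Y (Inr ` {..<s})"
  proof -
    have "bij_betw (Inr \<circ> h) Y (Inr ` {..<s})"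
      by (rule bij_betw_trans[OF h(1)]) (simp add: bij_betw_def)
    moreover have "bij_betw F Y Z = bij_betw (Inr \<circ> h) Y Z" for Z
      by (rule bij_betw_cong) (simp add: FY)
    ultimately show ?thesis by simp
  qed
  ultimately have "bij_betw F (X \<union> Y) (Inl ` {..<r} \<union> Inr ` {..<s})"
    by (rule bij_betw_combine) auto
  then have bij: "bij_betw F (verts \<Gamma>) (verts (Gamma_rs r s))"
    unfolding V(1) Gamma_rs_verts .
  have key: "adj \<Gamma> x y = \<tau> x * \<tau> y * adj (Gamma_rs r s) (F x) (F y)" if x: "x \<in> X" and y: "y \<in> Y" for x y
  proof -
    have \<theta>: "\<theta> x = real_of_int (\<tau> x)" and \<eta>: "\<eta> y = real_of_int (\<tau> y)"
    proof -
      have "\<theta> x = 1 \<or> \<theta> x = -1" "\<eta> y = 1 \<or> \<eta> y = -1"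
        using s unfolding is_signing_def by blast+
      then show "\<theta> x = real_of_int (\<tau> x)" "\<eta> y = real_of_int (\<tau> y)"
        using x YX[OF y] by (auto simp: \<tau>_def)
    qed
    have sq: "\<tau> x * \<tau> x = 1" "\<tau> y * \<tau> y = 1" by (simp_all add: \<tau>_def)
    have "real_of_int (adj (Gamma_rs r s) (F x) (F y)) = hexsign {0} {0} (r - 1) (s - 1) (g x) (h y)"
      unfolding FX[OF x] FY[OF y] by (rule adj_Gamma_rs[OF rs glt[OF x] hlt[OF y]])
    also have "\<dots> = hexsign {x2} {y2} x1 y1 x y"
      unfolding hexsign_def singleton_iff gi[OF x] hi[OF y] ..
    also have "\<dots> = \<tau> x * adj \<Gamma> x y * \<tau> y"
      unfolding w[OF x y, symmetric] resign_def \<theta> \<eta> by (simp only: of_int_mult)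
    finally have "adj (Gamma_rs r s) (F x) (F y) = \<tau> x * adj \<Gamma> x y * \<tau> y" by linarith
    then have "\<tau> x * \<tau> y * adj (Gamma_rs r s) (F x) (F y) = (\<tau> x * \<tau> x) * (\<tau> y * \<tau> y) * adj \<Gamma> x y"
      by (simp only: mult_ac)
    then show ?thesis by (simp add: sq)
  qed
  have "adj \<Gamma> x y = \<tau> x * \<tau> y * adj (Gamma_rs r s) (F x) (F y)"
    if xy: "x \<in> verts \<Gamma>" "y \<in> verts \<Gamma>" for x y
  proof -
    consider "x \<in> X" "y \<in> Y" | "x \<in> Y" "y \<in> X" | "x \<in> X" "y \<in> X" | "x \<in> Y" "y \<in> Y"
      using xy unfolding V(1) by blast
    then show ?thesis
    proof cases
      case 1
      then show ?thesis by (rule key)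
    next
      case 2
      then show ?thesis
        using key[of y x] by (simp add: adj_commute[of \<Gamma> x] adj_commute[of "Gamma_rs r s" "F x"] mult_ac)
    next
      case 3
      then have "adj \<Gamma> x y = 0" "adj (Gamma_rs r s) (F x) (F y) = 0"
        using adj_same_part(1)[OF G(2)] adj_same_part(1)[OF G'(2)] FX glt by simp_all
      then show ?thesis by simp
    next
      case 4
      then have "adj \<Gamma> x y = 0" "adj (Gamma_rs r s) (F x) (F y) = 0"
        using adj_same_part(2)[OF G(2)] adj_same_part(2)[OF G'(2)] FY hlt by simp_all
      then show ?thesis by simp
    qed
  qed
  then show ?thesis by (intro switching_isomorphicI[OF G(1) G'(1) bij, of \<tau>]) (simp_all add: \<tau>_def)
qed

text \<open>The explicit eigenvector of the extremal graph is carried over by the signed permutation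
  and regarded as a complex vector.\<close>

lemma sg_radius_ge_of_switching_isomorphic:
  assumes rs: "3 \<le> r" "r \<le> s" and G: "signed_graph \<Gamma>"
    and iso: "switching_isomorphic \<Gamma> (Gamma_rs r s)"
  shows "sqrt (beta_sq (real r - 1) (real s - 1)) \<le> sg_radius \<Gamma>"
proof -
  define L where "L = sqrt (beta_sq (real r - 1) (real s - 1))"
  define \<Delta> where "\<Delta> = Gamma_rs r s"
  have rs2: "2 \<le> r" "2 \<le> s" using rs by simp_all
  note D = signed_graph_Gamma_rs[OF rs2, folded \<Delta>_def] bipartition_Gamma_rs[OF rs2, folded \<Delta>_def]
  note VD = Gamma_rs_verts[of r s, folded \<Delta>_def]
  obtain f g j0 where j0: "j0 < s" "g j0 \<noteq> 0"
    and row: "\<And>i. i < r \<Longrightarrow> (\<Sum>j<s. hexsign {0} {0} (r - 1) (s - 1) i j * g j) = L * f i"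
    and col: "\<And>j. j < s \<Longrightarrow> (\<Sum>i<r. hexsign {0} {0} (r - 1) (s - 1) i j * f i) = L * g j"
    by (rule Gamma_rs_eigenvector[OF rs, folded L_def]) (rule that)
  define \<phi> :: "nat + nat \<Rightarrow> real" where "\<phi> = case_sum f g"
  have eig: "(\<Sum>z'\<in>verts \<Delta>. of_int (adj \<Delta> z z') * \<phi> z') = L * \<phi> z" if z: "z \<in> verts \<Delta>" for z
  proof -
    consider i where "i < r" "z = Inl i" | j where "j < s" "z = Inr j" using z unfolding VD by blast
    then show ?thesis
    proof cases
      case 1
      have "(\<Sum>z'\<in>verts \<Delta>. of_int (adj \<Delta> z z') * \<phi> z') = (\<Sum>z'\<in>Inr ` {..<s}. of_int (adj \<Delta> z z') * \<phi> z')"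
        by (rule sum_adj(1)[OF D]) (use 1 in auto)
      also have "\<dots> = (\<Sum>j<s. of_int (adj \<Delta> (Inl i) (Inr j)) * g j)"
        by (subst sum.reindex) (simp_all add: \<phi>_def 1)
      also have "\<dots> = L * f i"
        unfolding row[OF 1(1), symmetric] \<Delta>_def using 1 by (intro sum.cong refl) (simp add: adj_Gamma_rs[OF rs2])
      finally show ?thesis by (simp add: \<phi>_def 1)
    next
      case 2
      have "(\<Sum>z'\<in>verts \<Delta>. of_int (adj \<Delta> z z') * \<phi> z') = (\<Sum>z'\<in>Inl ` {..<r}. of_int (adj \<Delta> z' z) * \<phi> z')"
        by (rule sum_adj(2)[OF D]) (use 2 in auto)
      also have "\<dots> = (\<Sum>i<r. of_int (adj \<Delta> (Inl i) (Inr j)) * f i)"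
        by (subst sum.reindex) (simp_all add: \<phi>_def 2)
      also have "\<dots> = L * g j"
        unfolding col[OF 2(1), symmetric] \<Delta>_def using 2 by (intro sum.cong refl) (simp add: adj_Gamma_rs[OF rs2])
      finally show ?thesis by (simp add: \<phi>_def 2)
    qed
  qed
  obtain F and \<tau> :: "'a \<Rightarrow> int" where F: "bij_betw F (verts \<Gamma>) (verts \<Delta>)" and \<tau>: "\<And>x. \<tau> x * \<tau> x = 1"
    and adj: "\<And>x y. x \<in> verts \<Gamma> \<Longrightarrow> y \<in> verts \<Gamma> \<Longrightarrow> adj \<Gamma> x y = \<tau> x * \<tau> y * adj \<Delta> (F x) (F y)"
    by (rule switching_isomorphicD[OF G D(1) iso[folded \<Delta>_def]]) (rule that)
  \<comment> \<open>In the eigenvalue equation the sign of \<open>y\<close> occurs twice and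
    cancels, while the sign of \<open>x\<close> factors out.\<close>
  define d where "d x = real_of_int (\<tau> x) * \<phi> (F x)" for x
  have d: "(\<Sum>y\<in>verts \<Gamma>. of_int (adj \<Gamma> x y) * d y) = L * d x" if x: "x \<in> verts \<Gamma>" for x
  proof -
    have "(\<Sum>y\<in>verts \<Gamma>. of_int (adj \<Gamma> x y) * d y)
        = (\<Sum>y\<in>verts \<Gamma>. of_int (\<tau> x) * (of_int (adj \<Delta> (F x) (F y)) * \<phi> (F y)))"
    proof (rule sum.cong[OF refl])
      fix y assume "y \<in> verts \<Gamma>"
      have "real_of_int (adj \<Gamma> x y) * d y
          = of_int (\<tau> x) * of_int (\<tau> y * \<tau> y) * (of_int (adj \<Delta> (F x) (F y)) * \<phi> (F y))"
        unfolding adj[OF x \<open>y \<in> verts \<Gamma>\<close>] d_def of_int_mult by (simp only: mult_ac)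
      then show "real_of_int (adj \<Gamma> x y) * d y = of_int (\<tau> x) * (of_int (adj \<Delta> (F x) (F y)) * \<phi> (F y))"
        by (simp add: \<tau>)
    qed
    also have "\<dots> = of_int (\<tau> x) * (\<Sum>y\<in>verts \<Gamma>. of_int (adj \<Delta> (F x) (F y)) * \<phi> (F y))"
      by (simp add: sum_distrib_left)
    also have "(\<Sum>y\<in>verts \<Gamma>. of_int (adj \<Delta> (F x) (F y)) * \<phi> (F y)) = (\<Sum>z\<in>verts \<Delta>. of_int (adj \<Delta> (F x) z) * \<phi> z)"
      by (rule sum.reindex_bij_betw[OF F])
    also have "\<dots> = L * \<phi> (F x)" by (rule eig) (rule bij_betw_apply[OF F x])
    finally show ?thesis by (simp add: d_def mult_ac)
  qed
  have "Inr j0 \<in> F ` verts \<Gamma>" using j0 VD F by (auto simp: bij_betw_def)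
  then obtain x0 where x0: "x0 \<in> verts \<Gamma>" "F x0 = Inr j0" by (metis imageE)
  have "\<tau> x0 \<noteq> 0" using \<tau>[of x0] by auto
  then have "d x0 \<noteq> 0" using x0 j0 by (simp add: d_def \<phi>_def)
  moreover have "(\<Sum>y\<in>verts \<Gamma>. of_int (adj \<Gamma> x y) * complex_of_real (d y)) = complex_of_real L * complex_of_real (d x)"
    if "x \<in> verts \<Gamma>" for x
    using arg_cong[OF d[OF that], of complex_of_real] by simp
  ultimately have "norm (complex_of_real L) \<le> sg_radius \<Gamma>"
    by (intro norm_le_sg_radius[OF G x0(1), of "\<lambda>x. complex_of_real (d x)"]) simp_all
  then show ?thesis unfolding L_def[symmetric] by simp
qed

section \<open>The bound and its equality case for signed graphs\<close>

theorem theorem1p1: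
  fixes \<Gamma> :: "'a sgraph" and X Y :: "'a set" and r s :: nat
  assumes "3 \<le> r" and "r \<le> s"
    and "signed_graph \<Gamma>"
    and "bipartition \<Gamma> X Y" and "card X = r" and "card Y = s"
    and "unbalanced \<Gamma>"
    and "\<not> (\<exists>c. negative_cycle \<Gamma> c \<and> length c = 4)"
  shows "let \<beta> = sqrt (1/2 * ((real r - 1) * (real s - 1) + 2 +
      sqrt (((real r - 1) * (real s - 1) + 2)\<^sup>2 - 4 * (2 * real s - 3) * (2 * real r - 3))))
    in sg_radius \<Gamma> \<le> \<beta> \<and>
      (sg_radius \<Gamma> = \<beta> \<longleftrightarrow> switching_isomorphic \<Gamma> (Gamma_rs r s))"
proof -
  note G = assms(3,4)
  interpret unbalanced_array X Y "\<lambda>x y. real_of_int (adj \<Gamma> x y)"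
    by (rule unbalanced_array_adj[OF G assms(7,8)])
  have "X \<noteq> {}" using assms(1,5) by auto
  then have ne: "verts \<Gamma> \<noteq> {}" using bipartition_verts(1)[OF G] by simp
  define b where "b = sqrt (beta_sq (real r - 1) (real s - 1))"
  have b: "b = sqrt (1/2 * ((real r - 1) * (real s - 1) + 2 +
      sqrt (((real r - 1) * (real s - 1) + 2)\<^sup>2 - 4 * (2 * real s - 3) * (2 * real r - 3))))"
  proof -
    have "2 * (real s - 1) - 1 = 2 * real s - 3" "2 * (real r - 1) - 1 = 2 * real r - 3" by simp_all
    then show ?thesis unfolding b_def beta_sq_def by (simp only:)
  qed
  have \<beta>: "\<beta> = b" by (simp add: b_def assms)
  have le: "sg_radius \<Gamma> \<le> b" by (rule sg_radius_le_bil(1)[OF G ne bil_le[unfolded \<beta>]])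
  have "switching_isomorphic \<Gamma> (Gamma_rs r s)" if eq: "sg_radius \<Gamma> = b"
  proof -
    obtain f g where "sqn X f + sqn Y g \<noteq> 0"
      "2 * bil X Y (\<lambda>x y. real_of_int (adj \<Gamma> x y)) f g = \<beta> * (sqn X f + sqn Y g)"
      using sg_radius_le_bil(2)[OF G ne bil_le[unfolded \<beta>] eq] unfolding \<beta> by blast
    then obtain \<theta> \<eta> x1 x2 y1 y2 where *: "is_signing \<theta>" "is_signing \<eta>"
      "x1 \<in> X" "x2 \<in> X" "x1 \<noteq> x2" "y1 \<in> Y" "y2 \<in> Y" "y1 \<noteq> y2"
      "\<And>x y. x \<in> X \<Longrightarrow> y \<in> Y \<Longrightarrow>
        resign \<theta> \<eta> (\<lambda>x y. real_of_int (adj \<Gamma> x y)) x y = hexsign {x2} {y2} x1 y1 x y"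
      by (elim bil_extremal[rotated]) (rule that)
    show ?thesis by (rule switching_isomorphic_Gamma_rsI[OF G assms(5,6) *])
  qed
  \<comment> \<open>The upper bound \<open>le\<close> already covers \<open>\<Gamma>\<close>, so a
    lower bound by an eigenvalue gives equality.\<close>
  moreover have "sg_radius \<Gamma> = b" if "switching_isomorphic \<Gamma> (Gamma_rs r s)"
    using sg_radius_ge_of_switching_isomorphic[OF assms(1-3) that] le unfolding b_def by simp
  ultimately show ?thesis using le unfolding b[symmetric] Let_def by blast
qed

end
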